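(* Let $\mathcal V$ be a complete and cocomplete symmetric monoidal category and let $\kappa$ be a regular cardinal. Any collection of morphisms $S$ in $\mathcal V$ has a $\kappa$-closed monoidal multiplicative closure $\overline S$; that is, there is a $\kappa$-closed monoidal multiplicative system $\overline S$ containing $S$ such that, for every $\kappa$-closed monoidal multiplicative system $\overline S'$ containing $S$, the localization $L':\mathcal V\to\mathcal V[(\overline S')^{-1}]$ factors uniquely through the localization $L:\mathcal V\to\mathcal V[\overline S^{-1}]$.
   Context: $\mathcal V[T^{-1}]$ denotes the Gabriel–Zisman localization of $\mathcal V$ at a collection of morphisms $T$ (the universal category under $\mathcal V$ in which the morphisms of $T$ become invertible). A collection $S$ of morphisms is a right multiplicative system if: (1) it contains all identities; (2) it is closed under composition; (3) for $f_1:X\to Y$ in $\mathcal V$ and $s:X\to X'$ in $S$ there are $f_2:X'\to Y'$ in $\mathcal V$ and $t:Y\to Y'$ in $S$ with $f_2s=tf_1$; (4) if $g_1,g_2:X\rightrightarrows Y$ are morphisms in $\mathcal V$ and $s:W\to X$ is in $S$ with $g_1s=g_2s$, then there is $t:Y\to Z$ in $S$ with $tg_1=tg_2$. Left multiplicative systems are defined dually, and a multiplicative system is a collection which is both. A multiplicative system is $\kappa$-closed if it is closed under $\kappa$-small products and coproducts of morphisms. A collection of morphisms is monoidal if it is closed under tensoring with identity maps $\mathrm{id}_X$ for all $X\in\mathcal V$. *)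

theory Defs
  imports "HOL-Library.FuncSet"
begin

unbundle cardinal_syntax

section \<open>Categories and functors\<close>

record ('o, 'm) cat =
  Obj :: "'o set"
  Arr :: "'m set"
  Dom :: "'m \<Rightarrow> 'o"
  Cod :: "'m \<Rightarrow> 'o"
  Id :: "'o \<Rightarrow> 'm"
  Comp :: "'m \<Rightarrow> 'm \<Rightarrow> 'm" (infixl "\<cdot>\<index>" 70)

definition hom :: "('o, 'm, 'z) cat_scheme \<Rightarrow> 'o \<Rightarrow> 'o \<Rightarrow> 'm set" where
  "hom C x y = {f \<in> Arr C. Dom C f = x \<and> Cod C f = y}"

locale category =
  fixes C :: "('o, 'm, 'z) cat_scheme" (structure)
  assumes Dom_in: "f \<in> Arr C \<Longrightarrow> Dom C f \<in> Obj C"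
    and Cod_in: "f \<in> Arr C \<Longrightarrow> Cod C f \<in> Obj C"
    and Id_in: "x \<in> Obj C \<Longrightarrow> Id C x \<in> hom C x x"
    and Comp_in: "\<lbrakk>f \<in> hom C x y; g \<in> hom C y z\<rbrakk> \<Longrightarrow> g \<cdot> f \<in> hom C x z"
    and Id_left: "f \<in> hom C x y \<Longrightarrow> Id C y \<cdot> f = f"
    and Id_right: "f \<in> hom C x y \<Longrightarrow> f \<cdot> Id C x = f"
    and Comp_assoc:
      "\<lbrakk>f \<in> hom C w x; g \<in> hom C x y; h \<in> hom C y z\<rbrakk> \<Longrightarrow> (h \<cdot> g) \<cdot> f = h \<cdot> (g \<cdot> f)"

definition op_cat :: "('o, 'm, 'z) cat_scheme \<Rightarrow> ('o, 'm) cat" where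
  "op_cat C = \<lparr>Obj = Obj C, Arr = Arr C, Dom = Cod C, Cod = Dom C, Id = Id C,
     Comp = (\<lambda>g f. Comp C f g)\<rparr>"

definition inverse_arrows :: "('o, 'm, 'z) cat_scheme \<Rightarrow> 'm \<Rightarrow> 'm \<Rightarrow> bool" where
  "inverse_arrows C f g \<longleftrightarrow>
     f \<in> Arr C \<and> g \<in> hom C (Cod C f) (Dom C f) \<and>
     Comp C g f = Id C (Dom C f) \<and> Comp C f g = Id C (Cod C f)"

definition is_iso :: "('o, 'm, 'z) cat_scheme \<Rightarrow> 'm \<Rightarrow> bool" where
  "is_iso C f \<longleftrightarrow> (\<exists>g. inverse_arrows C f g)"

text \<open>The two maps of a functor are required to be extensional on the source category,
  so that equality of functors is equality of records.\<close>

record ('o, 'm, 'p, 'n) fctr =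
  omap :: "'o \<Rightarrow> 'p"
  amap :: "'m \<Rightarrow> 'n"

definition is_functor ::
  "('o, 'm, 'y) cat_scheme \<Rightarrow> ('p, 'n, 'z) cat_scheme \<Rightarrow> ('o, 'm, 'p, 'n) fctr \<Rightarrow> bool" where
  "is_functor C D F \<longleftrightarrow>
     omap F \<in> Obj C \<rightarrow>\<^sub>E Obj D \<and> amap F \<in> Arr C \<rightarrow>\<^sub>E Arr D \<and>
     (\<forall>f\<in>Arr C. Dom D (amap F f) = omap F (Dom C f) \<and> Cod D (amap F f) = omap F (Cod C f)) \<and>
     (\<forall>x\<in>Obj C. amap F (Id C x) = Id D (omap F x)) \<and>
     (\<forall>f\<in>Arr C. \<forall>g\<in>Arr C. Cod C f = Dom C g \<longrightarrow>
        amap F (Comp C g f) = Comp D (amap F g) (amap F f))"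

definition fctr_comp ::
  "('o, 'm, 'y) cat_scheme \<Rightarrow> ('p, 'n, 'q, 'k) fctr \<Rightarrow> ('o, 'm, 'p, 'n) fctr
    \<Rightarrow> ('o, 'm, 'q, 'k) fctr" where
  "fctr_comp C G F =
     \<lparr>omap = compose (Obj C) (omap G) (omap F), amap = compose (Arr C) (amap G) (amap F)\<rparr>"


section \<open>Completeness and cocompleteness\<close>

text \<open>The type \<open>'u\<close> plays the role of the universe: a set is small if its cardinality is
  strictly below that of \<open>'u\<close>. Every small category is isomorphic to one whose objects and
  arrows are elements of \<open>'u\<close>, so that only such shapes need to be considered. (Smallness of
  the set of objects follows from that of the set of arrows, by way of identities.) The usual
  notions are obtained when the cardinality of \<open>'u\<close> is inaccessible, but this is not imposed.\<close>

definition is_cone ::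
  "('i, 'j, 'y) cat_scheme \<Rightarrow> ('o, 'm, 'z) cat_scheme \<Rightarrow> ('i, 'j, 'o, 'm) fctr
    \<Rightarrow> 'o \<Rightarrow> ('i \<Rightarrow> 'm) \<Rightarrow> bool" where
  "is_cone J C D x \<phi> \<longleftrightarrow> x \<in> Obj C \<and> (\<forall>i\<in>Obj J. \<phi> i \<in> hom C x (omap D i)) \<and>
     (\<forall>a\<in>Arr J. Comp C (amap D a) (\<phi> (Dom J a)) = \<phi> (Cod J a))"

definition is_limit_cone ::
  "('i, 'j, 'y) cat_scheme \<Rightarrow> ('o, 'm, 'z) cat_scheme \<Rightarrow> ('i, 'j, 'o, 'm) fctr
    \<Rightarrow> 'o \<Rightarrow> ('i \<Rightarrow> 'm) \<Rightarrow> bool" where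
  "is_limit_cone J C D x \<phi> \<longleftrightarrow> is_cone J C D x \<phi> \<and>
     (\<forall>y \<psi>. is_cone J C D y \<psi> \<longrightarrow>
        (\<exists>!h. h \<in> hom C y x \<and> (\<forall>i\<in>Obj J. Comp C (\<phi> i) h = \<psi> i)))"

definition complete_category :: "'u itself \<Rightarrow> ('o, 'm, 'z) cat_scheme \<Rightarrow> bool" where
  "complete_category U C \<longleftrightarrow>
     (\<forall>(J :: ('u, 'u) cat) D. category J \<and> |Arr J| <o |UNIV :: 'u set| \<and> is_functor J C D \<longrightarrow>
        (\<exists>x \<phi>. is_limit_cone J C D x \<phi>))"

definition cocomplete_category :: "'u itself \<Rightarrow> ('o, 'm, 'z) cat_scheme \<Rightarrow> bool" where
  "cocomplete_category U C \<longleftrightarrow> complete_category U (op_cat C)"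


section \<open>Symmetric monoidal categories\<close>

record ('o, 'm) smcat = "('o, 'm) cat" +
  tens :: "'o \<Rightarrow> 'o \<Rightarrow> 'o" (infixr "\<otimes>\<index>" 75)
  tensA :: "'m \<Rightarrow> 'm \<Rightarrow> 'm" (infixr "\<boxtimes>\<index>" 75)
  tunit :: "'o"
  assoc :: "'o \<Rightarrow> 'o \<Rightarrow> 'o \<Rightarrow> 'm"
  lunit :: "'o \<Rightarrow> 'm"
  runit :: "'o \<Rightarrow> 'm"
  braid :: "'o \<Rightarrow> 'o \<Rightarrow> 'm"

locale symmetric_monoidal_category = category V
  for V :: "('o, 'm, 'z) smcat_scheme" (structure) +
  assumes tens_in: "\<lbrakk>x \<in> Obj V; y \<in> Obj V\<rbrakk> \<Longrightarrow> x \<otimes> y \<in> Obj V"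
    and tensA_in: "\<lbrakk>f \<in> hom V x x'; g \<in> hom V y y'\<rbrakk> \<Longrightarrow> f \<boxtimes> g \<in> hom V (x \<otimes> y) (x' \<otimes> y')"
    and tensA_Id: "\<lbrakk>x \<in> Obj V; y \<in> Obj V\<rbrakk> \<Longrightarrow> Id V x \<boxtimes> Id V y = Id V (x \<otimes> y)"
    and tensA_Comp:
      "\<lbrakk>f \<in> hom V x x'; f' \<in> hom V x' x''; g \<in> hom V y y'; g' \<in> hom V y' y''\<rbrakk> \<Longrightarrow>
         (f' \<cdot> f) \<boxtimes> (g' \<cdot> g) = (f' \<boxtimes> g') \<cdot> (f \<boxtimes> g)"
    and tunit_in: "tunit V \<in> Obj V"
    and assoc_in: "\<lbrakk>x \<in> Obj V; y \<in> Obj V; z \<in> Obj V\<rbrakk> \<Longrightarrow>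
         assoc V x y z \<in> hom V ((x \<otimes> y) \<otimes> z) (x \<otimes> (y \<otimes> z))"
    and assoc_iso: "\<lbrakk>x \<in> Obj V; y \<in> Obj V; z \<in> Obj V\<rbrakk> \<Longrightarrow> is_iso V (assoc V x y z)"
    and assoc_natural:
      "\<lbrakk>f \<in> hom V x x'; g \<in> hom V y y'; h \<in> hom V z z'\<rbrakk> \<Longrightarrow>
         assoc V x' y' z' \<cdot> ((f \<boxtimes> g) \<boxtimes> h) = (f \<boxtimes> (g \<boxtimes> h)) \<cdot> assoc V x y z"
    and lunit_in: "x \<in> Obj V \<Longrightarrow> lunit V x \<in> hom V (tunit V \<otimes> x) x"
    and lunit_iso: "x \<in> Obj V \<Longrightarrow> is_iso V (lunit V x)"
    and lunit_natural: "f \<in> hom V x x' \<Longrightarrow>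
         lunit V x' \<cdot> (Id V (tunit V) \<boxtimes> f) = f \<cdot> lunit V x"
    and runit_in: "x \<in> Obj V \<Longrightarrow> runit V x \<in> hom V (x \<otimes> tunit V) x"
    and runit_iso: "x \<in> Obj V \<Longrightarrow> is_iso V (runit V x)"
    and runit_natural: "f \<in> hom V x x' \<Longrightarrow>
         runit V x' \<cdot> (f \<boxtimes> Id V (tunit V)) = f \<cdot> runit V x"
    and braid_in: "\<lbrakk>x \<in> Obj V; y \<in> Obj V\<rbrakk> \<Longrightarrow> braid V x y \<in> hom V (x \<otimes> y) (y \<otimes> x)"
    and braid_natural: "\<lbrakk>f \<in> hom V x x'; g \<in> hom V y y'\<rbrakk> \<Longrightarrow>
         braid V x' y' \<cdot> (f \<boxtimes> g) = (g \<boxtimes> f) \<cdot> braid V x y"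
    and braid_symmetry: "\<lbrakk>x \<in> Obj V; y \<in> Obj V\<rbrakk> \<Longrightarrow>
         braid V y x \<cdot> braid V x y = Id V (x \<otimes> y)"
    and pentagon: "\<lbrakk>w \<in> Obj V; x \<in> Obj V; y \<in> Obj V; z \<in> Obj V\<rbrakk> \<Longrightarrow>
         assoc V w x (y \<otimes> z) \<cdot> assoc V (w \<otimes> x) y z =
         (Id V w \<boxtimes> assoc V x y z) \<cdot> assoc V w (x \<otimes> y) z \<cdot> (assoc V w x y \<boxtimes> Id V z)"
    and triangle: "\<lbrakk>x \<in> Obj V; y \<in> Obj V\<rbrakk> \<Longrightarrow>
         (Id V x \<boxtimes> lunit V y) \<cdot> assoc V x (tunit V) y = runit V x \<boxtimes> Id V y"
    and hexagon: "\<lbrakk>x \<in> Obj V; y \<in> Obj V; z \<in> Obj V\<rbrakk> \<Longrightarrow>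
         assoc V y z x \<cdot> braid V x (y \<otimes> z) \<cdot> assoc V x y z =
         (Id V y \<boxtimes> braid V x z) \<cdot> assoc V y x z \<cdot> (braid V x y \<boxtimes> Id V z)"


section \<open>Multiplicative systems\<close>

definition right_multiplicative_system :: "('o, 'm, 'z) cat_scheme \<Rightarrow> 'm set \<Rightarrow> bool" where
  "right_multiplicative_system C S \<longleftrightarrow> S \<subseteq> Arr C \<and>
     (\<forall>x\<in>Obj C. Id C x \<in> S) \<and>
     (\<forall>s\<in>S. \<forall>t\<in>S. Cod C s = Dom C t \<longrightarrow> Comp C t s \<in> S) \<and>
     (\<forall>f1\<in>Arr C. \<forall>s\<in>S. Dom C f1 = Dom C s \<longrightarrow>
        (\<exists>f2\<in>Arr C. \<exists>t\<in>S. Dom C f2 = Cod C s \<and> Dom C t = Cod C f1 \<and> Cod C f2 = Cod C t \<and>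
           Comp C f2 s = Comp C t f1)) \<and>
     (\<forall>x y. \<forall>g1\<in>hom C x y. \<forall>g2\<in>hom C x y. \<forall>s\<in>S. Cod C s = x \<and> Comp C g1 s = Comp C g2 s \<longrightarrow>
        (\<exists>t\<in>S. Dom C t = y \<and> Comp C t g1 = Comp C t g2))"

definition left_multiplicative_system :: "('o, 'm, 'z) cat_scheme \<Rightarrow> 'm set \<Rightarrow> bool" where
  "left_multiplicative_system C S \<longleftrightarrow> right_multiplicative_system (op_cat C) S"

definition multiplicative_system :: "('o, 'm, 'z) cat_scheme \<Rightarrow> 'm set \<Rightarrow> bool" where
  "multiplicative_system C S \<longleftrightarrow>
     left_multiplicative_system C S \<and> right_multiplicative_system C S"

definition regular_cardinal :: "'u rel \<Rightarrow> bool" where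
  "regular_cardinal \<kappa> \<longleftrightarrow> Card_order \<kappa> \<and> cinfinite \<kappa> \<and> regularCard \<kappa>"

definition is_product ::
  "('o, 'm, 'z) cat_scheme \<Rightarrow> 'i set \<Rightarrow> ('i \<Rightarrow> 'o) \<Rightarrow> 'o \<Rightarrow> ('i \<Rightarrow> 'm) \<Rightarrow> bool" where
  "is_product C I X p \<pi> \<longleftrightarrow> p \<in> Obj C \<and> (\<forall>i\<in>I. \<pi> i \<in> hom C p (X i)) \<and>
     (\<forall>y\<in>Obj C. \<forall>\<psi>. (\<forall>i\<in>I. \<psi> i \<in> hom C y (X i)) \<longrightarrow>
        (\<exists>!h. h \<in> hom C y p \<and> (\<forall>i\<in>I. Comp C (\<pi> i) h = \<psi> i)))"

text \<open>A product of a family of arrows is the arrow it induces between any products of the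
  domains and of the codomains. Every family of fewer than \<open>\<kappa>\<close> arrows can be reindexed by a
  subset of the field of \<open>\<kappa>\<close>, so that index sets in the type of \<open>\<kappa>\<close> suffice. As there is
  no choice of products, a collection that is closed under \<open>\<kappa>\<close>-small products and contains
  the identities contains all isomorphisms.\<close>

definition closed_under_products :: "('o, 'm, 'z) cat_scheme \<Rightarrow> 'u rel \<Rightarrow> 'm set \<Rightarrow> bool" where
  "closed_under_products C \<kappa> S \<longleftrightarrow>
     (\<forall>(I :: 'u set) f p \<pi> q \<rho> h.
        |I| <o \<kappa> \<and> (\<forall>i\<in>I. f i \<in> S) \<and>
        is_product C I (\<lambda>i. Dom C (f i)) p \<pi> \<and> is_product C I (\<lambda>i. Cod C (f i)) q \<rho> \<and>
        h \<in> hom C p q \<and> (\<forall>i\<in>I. Comp C (\<rho> i) h = Comp C (f i) (\<pi> i)) \<longrightarrow> h \<in> S)"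

definition closed_under_coproducts :: "('o, 'm, 'z) cat_scheme \<Rightarrow> 'u rel \<Rightarrow> 'm set \<Rightarrow> bool" where
  "closed_under_coproducts C \<kappa> S \<longleftrightarrow> closed_under_products (op_cat C) \<kappa> S"

definition monoidal_arrows :: "('o, 'm, 'z) smcat_scheme \<Rightarrow> 'm set \<Rightarrow> bool" where
  "monoidal_arrows V S \<longleftrightarrow>
     (\<forall>x\<in>Obj V. \<forall>s\<in>S. tensA V (Id V x) s \<in> S \<and> tensA V s (Id V x) \<in> S)"

definition closed_monoidal_multiplicative_system ::
  "('o, 'm, 'z) smcat_scheme \<Rightarrow> 'u rel \<Rightarrow> 'm set \<Rightarrow> bool" where
  "closed_monoidal_multiplicative_system V \<kappa> S \<longleftrightarrow>
     multiplicative_system V S \<and> closed_under_products V \<kappa> S \<and> closed_under_coproducts V \<kappa> S \<and>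
     monoidal_arrows V S"


section \<open>Gabriel--Zisman localization\<close>

text \<open>The arrows of \<open>C[T\<^sup>-\<^sup>1]\<close> are classes of zigzags: lists of arrows of \<open>C\<close> and of formal
  inverses of arrows in \<open>T\<close>, in order of traversal, modulo the smallest congruence that makes
  \<open>C \<rightarrow> C[T\<^sup>-\<^sup>1]\<close> a functor and the formal inverses inverses. An arrow records its
  domain and codomain, as the class of the empty zigzag does not determine them. The
  universal property is \<open>localization_universal\<close> below.\<close>

datatype 'm step = Fwd 'm | Bwd 'm

primrec zigzag :: "('o, 'm, 'z) cat_scheme \<Rightarrow> 'm set \<Rightarrow> 'o \<Rightarrow> 'm step list \<Rightarrow> 'o \<Rightarrow> bool" where
  "zigzag C T x [] y \<longleftrightarrow> x \<in> Obj C \<and> x = y"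
| "zigzag C T x (p # ps) y \<longleftrightarrow> (case p of
     Fwd f \<Rightarrow> f \<in> Arr C \<and> Dom C f = x \<and> zigzag C T (Cod C f) ps y
   | Bwd s \<Rightarrow> s \<in> T \<and> s \<in> Arr C \<and> Cod C s = x \<and> zigzag C T (Dom C s) ps y)"

inductive zz_eq ::
  "('o, 'm, 'z) cat_scheme \<Rightarrow> 'm set \<Rightarrow> 'o \<Rightarrow> 'o \<Rightarrow> 'm step list \<Rightarrow> 'm step list \<Rightarrow> bool"
  for C T where
  refl: "zigzag C T x p y \<Longrightarrow> zz_eq C T x y p p"
| sym: "zz_eq C T x y p q \<Longrightarrow> zz_eq C T x y q p"
| trans: "\<lbrakk>zz_eq C T x y p q; zz_eq C T x y q r\<rbrakk> \<Longrightarrow> zz_eq C T x y p r"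
| append: "\<lbrakk>zz_eq C T x y p q; zz_eq C T y z p' q'\<rbrakk> \<Longrightarrow> zz_eq C T x z (p @ p') (q @ q')"
| comp: "\<lbrakk>f \<in> hom C x y; g \<in> hom C y z\<rbrakk> \<Longrightarrow> zz_eq C T x z [Fwd f, Fwd g] [Fwd (Comp C g f)]"
| ident: "x \<in> Obj C \<Longrightarrow> zz_eq C T x x [Fwd (Id C x)] []"
| inv_right: "\<lbrakk>s \<in> T; s \<in> hom C x y\<rbrakk> \<Longrightarrow> zz_eq C T x x [Fwd s, Bwd s] []"
| inv_left: "\<lbrakk>s \<in> T; s \<in> hom C x y\<rbrakk> \<Longrightarrow> zz_eq C T y y [Bwd s, Fwd s] []"

definition zz_class ::
  "('o, 'm, 'z) cat_scheme \<Rightarrow> 'm set \<Rightarrow> 'o \<Rightarrow> 'm step list \<Rightarrow> 'o \<Rightarrow> 'o \<times> 'm step list set \<times> 'o" where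
  "zz_class C T x p y = (x, {q. zz_eq C T x y p q}, y)"

definition localization ::
  "('o, 'm, 'z) cat_scheme \<Rightarrow> 'm set \<Rightarrow> ('o, 'o \<times> 'm step list set \<times> 'o) cat" where
  "localization C T =
     \<lparr>Obj = Obj C,
      Arr = {zz_class C T x p y | x p y. zigzag C T x p y},
      Dom = (\<lambda>(x, P, y). x),
      Cod = (\<lambda>(x, P, y). y),
      Id = (\<lambda>x. zz_class C T x [] x),
      Comp = (\<lambda>(y', Q, z) (x, P, y). (x, {r. \<exists>p\<in>P. \<exists>q\<in>Q. zz_eq C T x z (p @ q) r}, z))\<rparr>"

definition localization_fctr ::
  "('o, 'm, 'z) cat_scheme \<Rightarrow> 'm set \<Rightarrow> ('o, 'm, 'o, 'o \<times> 'm step list set \<times> 'o) fctr" where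
  "localization_fctr C T =
     \<lparr>omap = restrict (\<lambda>x. x) (Obj C),
      amap = restrict (\<lambda>f. zz_class C T (Dom C f) [Fwd f] (Cod C f)) (Arr C)\<rparr>"

lemma zigzag_append:
  "zigzag C T x (p @ q) z \<longleftrightarrow> (\<exists>y. zigzag C T x p y \<and> zigzag C T y q z)"
  if "category C"
proof (induction p arbitrary: x)
  case Nil
  have "zigzag C T x q z \<Longrightarrow> x \<in> Obj C"
    using that by (cases q) (auto simp: category_def split: step.splits)
  then show ?case by auto
next
  case (Cons a p)
  then show ?case by (auto split: step.splits)
qed

lemma zigzag_objs:
  assumes "category C" "zigzag C T x p y"
  shows "x \<in> Obj C" "y \<in> Obj C"
proof -
  show "x \<in> Obj C"
    using assms by (cases p) (auto simp: category_def split: step.splits)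
  show "y \<in> Obj C"
    using assms by (induction p arbitrary: x) (auto split: step.splits)
qed

lemma zz_eq_zigzag:
  assumes "category C" "zz_eq C T x y p q"
  shows "zigzag C T x p y \<and> zigzag C T x q y"
  using assms(2)
proof (induction rule: zz_eq.induct)
  case (append x y p q z p' q')
  then show ?case by (auto simp: zigzag_append[OF assms(1)])
next
  case (comp f x y g z)
  then have "Comp C g f \<in> hom C x z" using category.Comp_in[OF assms(1)] by blast
  with comp category.Cod_in[OF assms(1)] show ?case by (auto simp: hom_def)
next
  case (ident x)
  then show ?case using category.Id_in[OF assms(1) ident] by (auto simp: hom_def)
qed (use category.Dom_in[OF assms(1)] category.Cod_in[OF assms(1)] in \<open>auto simp: hom_def\<close>)

lemma zz_class_eq_iff:
  assumes "zigzag C T x p y"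
  shows "zz_class C T x p y = zz_class C T x' q y' \<longleftrightarrow> x = x' \<and> y = y' \<and> zz_eq C T x y p q"
  using assms unfolding zz_class_def
  by (auto intro: zz_eq.refl zz_eq.sym zz_eq.trans)

lemma localization_Comp:
  assumes "category C" "zigzag C T x p y" "zigzag C T y q z"
  shows "Comp (localization C T) (zz_class C T y q z) (zz_class C T x p y) = zz_class C T x (p @ q) z"
  using assms unfolding zz_class_def localization_def
  by (auto intro: zz_eq.refl zz_eq.trans zz_eq.append)

lemma localization_homE:
  assumes "f \<in> hom (localization C T) x y"
  obtains p where "zigzag C T x p y" "f = zz_class C T x p y"
  using assms by (auto simp: hom_def localization_def zz_class_def)

lemma zz_class_hom:
  "zigzag C T x p y \<Longrightarrow> zz_class C T x p y \<in> hom (localization C T) x y"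
  by (auto simp: hom_def localization_def zz_class_def)

lemma category_localization:
  assumes "category C"
  shows "category (localization C T)"
proof
  fix f assume "f \<in> Arr (localization C T)"
  then show "Dom (localization C T) f \<in> Obj (localization C T)"
    "Cod (localization C T) f \<in> Obj (localization C T)"
    using zigzag_objs[OF assms] by (auto simp: localization_def zz_class_def)
next
  fix x assume "x \<in> Obj (localization C T)"
  then show "Id (localization C T) x \<in> hom (localization C T) x x"
    using zz_class_hom[of C T x "[]" x] by (simp add: localization_def)
next
  fix f x y g z
  assume "f \<in> hom (localization C T) x y" "g \<in> hom (localization C T) y z"
  then show "Comp (localization C T) g f \<in> hom (localization C T) x z"
    using assms
    by (metis localization_homE localization_Comp zz_class_hom zigzag_append)
next
  fix f x y
  assume "f \<in> hom (localization C T) x y"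
  then obtain p where p: "zigzag C T x p y" "f = zz_class C T x p y"
    by (rule localization_homE)
  have z: "zigzag C T y [] y" "zigzag C T x [] x" using zigzag_objs[OF assms p(1)] by auto
  have i: "Id (localization C T) u = zz_class C T u [] u" for u by (simp add: localization_def)
  show "Comp (localization C T) (Id (localization C T) y) f = f"
    unfolding i p(2) localization_Comp[OF assms p(1) z(1)] by simp
  show "Comp (localization C T) f (Id (localization C T) x) = f"
    unfolding i p(2) localization_Comp[OF assms z(2) p(1)] by simp
next
  fix f w x g y h z
  assume "f \<in> hom (localization C T) w x" "g \<in> hom (localization C T) x y"
    "h \<in> hom (localization C T) y z"
  then obtain p q r where pqr: "zigzag C T w p x" "f = zz_class C T w p x"
    "zigzag C T x q y" "g = zz_class C T x q y" "zigzag C T y r z" "h = zz_class C T y r z"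
    by (metis localization_homE)
  have a: "zigzag C T w (p @ q) y" "zigzag C T x (q @ r) z"
    using pqr zigzag_append[OF assms] by blast+
  show "Comp (localization C T) (Comp (localization C T) h g) f =
    Comp (localization C T) h (Comp (localization C T) g f)"
    using pqr a by (simp add: localization_Comp[OF assms])
qed

lemma localization_fctr_functor:
  assumes "category C"
  shows "is_functor C (localization C T) (localization_fctr C T)"
proof -
  have z: "zigzag C T (Dom C f) [Fwd f] (Cod C f)" if "f \<in> Arr C" for f
    using that category.Cod_in[OF assms] by auto
  have i: "Id C x \<in> Arr C \<and> Dom C (Id C x) = x \<and> Cod C (Id C x) = x" if "x \<in> Obj C" for x
    using category.Id_in[OF assms that] by (simp add: hom_def)
  have c: "Comp C g f \<in> Arr C \<and> Dom C (Comp C g f) = Dom C f \<and> Cod C (Comp C g f) = Cod C g"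
    if "f \<in> Arr C" "g \<in> Arr C" "Cod C f = Dom C g" for f g
    using category.Comp_in[OF assms, of f "Dom C f" "Cod C f" g "Cod C g"] that
    by (simp add: hom_def)
  have 1: "amap (localization_fctr C T) (Id C x) = zz_class C T x [] x" if "x \<in> Obj C" for x
    using i[OF that] z[of "Id C x"] zz_eq.ident[OF that, of T] that
    by (simp add: localization_fctr_def zz_class_eq_iff)
  have 2: "zz_class C T (Dom C f) [Fwd (Comp C g f)] (Cod C g) =
      Comp (localization C T) (zz_class C T (Dom C g) [Fwd g] (Cod C g))
        (zz_class C T (Dom C f) [Fwd f] (Cod C f))"
    if "f \<in> Arr C" "g \<in> Arr C" "Cod C f = Dom C g" for f g
  proof -
    have "zz_eq C T (Dom C f) (Cod C g) [Fwd f, Fwd g] [Fwd (Comp C g f)]"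
      using that by (intro zz_eq.comp[of _ _ _ "Cod C f"]) (auto simp: hom_def)
    then have "zz_class C T (Dom C f) [Fwd (Comp C g f)] (Cod C g) =
        zz_class C T (Dom C f) ([Fwd f] @ [Fwd g]) (Cod C g)"
      using c[OF that] z[of "Comp C g f"] by (simp add: zz_class_eq_iff zz_eq.sym)
    then show ?thesis
      using localization_Comp[OF assms, of T "Dom C f" "[Fwd f]" "Cod C f" "[Fwd g]" "Cod C g"]
        z[OF that(1)] z[OF that(2)] that(3) by simp
  qed
  have 3: "amap (localization_fctr C T) f \<in> hom (localization C T) (Dom C f) (Cod C f)"
    if "f \<in> Arr C" for f
    using zz_class_hom[OF z[OF that]] that by (simp add: localization_fctr_def)
  have 4: "Id (localization C T) x = zz_class C T x [] x" "Obj (localization C T) = Obj C" for x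
    by (simp_all add: localization_def)
  show ?thesis
    unfolding is_functor_def
  proof (intro conjI ballI impI)
    show "omap (localization_fctr C T) \<in> Obj C \<rightarrow>\<^sub>E Obj (localization C T)"
      by (auto simp: localization_fctr_def 4)
    have "amap (localization_fctr C T) \<in> extensional (Arr C)"
      by (simp add: localization_fctr_def)
    then show "amap (localization_fctr C T) \<in> Arr C \<rightarrow>\<^sub>E Arr (localization C T)"
      using 3 by (auto simp: PiE_def hom_def)
  next
    fix f assume f: "f \<in> Arr C"
    with 3[OF f] category.Dom_in[OF assms f] category.Cod_in[OF assms f]
    show "Dom (localization C T) (amap (localization_fctr C T) f) =
        omap (localization_fctr C T) (Dom C f)"
      "Cod (localization C T) (amap (localization_fctr C T) f) =
        omap (localization_fctr C T) (Cod C f)"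
      by (simp_all add: hom_def localization_fctr_def)
  next
    fix x assume x: "x \<in> Obj C"
    show "amap (localization_fctr C T) (Id C x) =
      Id (localization C T) (omap (localization_fctr C T) x)"
      unfolding 1[OF x] 4 using x by (simp add: localization_fctr_def)
  next
    fix f g assume "f \<in> Arr C" "g \<in> Arr C" "Cod C f = Dom C g"
    with 2[OF this] c[OF this] show "amap (localization_fctr C T) (Comp C g f) =
      Comp (localization C T) (amap (localization_fctr C T) g) (amap (localization_fctr C T) f)"
      by (simp add: localization_fctr_def)
  qed
qed

lemma zz_class_Bwd_inverse:
  assumes "category C" "s \<in> T" "s \<in> Arr C"
  shows "inverse_arrows (localization C T) (amap (localization_fctr C T) s)
    (zz_class C T (Cod C s) [Bwd s] (Dom C s))"
proof -
  let ?x = "Dom C s" and ?y = "Cod C s"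
  have o: "?x \<in> Obj C" "?y \<in> Obj C"
    using category.Dom_in[OF assms(1,3)] category.Cod_in[OF assms(1,3)] by auto
  have z: "zigzag C T ?x [Fwd s] ?y" "zigzag C T ?y [Bwd s] ?x"
    using assms o by auto
  have a: "amap (localization_fctr C T) s = zz_class C T ?x [Fwd s] ?y"
    using assms by (simp add: localization_fctr_def)
  have d: "Dom (localization C T) (zz_class C T ?x [Fwd s] ?y) = ?x"
    "Cod (localization C T) (zz_class C T ?x [Fwd s] ?y) = ?y"
    "Id (localization C T) x = zz_class C T x [] x" for x
    by (simp_all add: localization_def zz_class_def)
  have e: "zz_eq C T ?x ?x ([Fwd s] @ [Bwd s]) []" "zz_eq C T ?y ?y ([Bwd s] @ [Fwd s]) []"
    using zz_eq.inv_right[of s T C ?x ?y] zz_eq.inv_left[of s T C ?x ?y] assms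
    by (auto simp: hom_def)
  show ?thesis
    unfolding inverse_arrows_def a d localization_Comp[OF assms(1) z]
      localization_Comp[OF assms(1) z(2,1)]
    using zz_class_hom[OF z(1)] zz_class_hom[OF z(2)] e zz_eq_zigzag[OF assms(1) e(1)]
      zz_eq_zigzag[OF assms(1) e(2)]
    by (auto simp: hom_def zz_class_eq_iff)
qed

text \<open>The universal property, for target categories of arbitrary type.\<close>

context
  fixes C :: "('o, 'm, 'z) cat_scheme" and T :: "'m set"
    and D :: "('p, 'n, 'y) cat_scheme" and F :: "('o, 'm, 'p, 'n) fctr"
begin

primrec zz_eval :: "'o \<Rightarrow> 'm step list \<Rightarrow> 'n" where
  "zz_eval x [] = Id D (omap F x)"
| "zz_eval x (p # ps) = (case p of
     Fwd f \<Rightarrow> Comp D (zz_eval (Cod C f) ps) (amap F f)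
   | Bwd s \<Rightarrow> Comp D (zz_eval (Dom C s) ps) (SOME g. inverse_arrows D (amap F s) g))"

lemma localization_universal:
  assumes C: "category C" and D: "category D" and F: "is_functor C D F"
    and T: "\<And>s. s \<in> T \<Longrightarrow> s \<in> Arr C \<Longrightarrow> is_iso D (amap F s)"
  shows "\<exists>!G. is_functor (localization C T) D G \<and> fctr_comp C G (localization_fctr C T) = F"
proof -
  interpret D: category D by fact
  let ?W = "localization C T" and ?L = "localization_fctr C T"
  define iv where "iv s = (SOME g. inverse_arrows D (amap F s) g)" for s
  have iv: "inverse_arrows D (amap F s) (iv s)" if "s \<in> T" "s \<in> Arr C" for s
    using T[OF that] unfolding is_iso_def iv_def by (rule someI_ex)
  have Fo: "omap F x \<in> Obj D" if "x \<in> Obj C" for x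
    using F that by (auto simp: is_functor_def)
  have Fa: "amap F f \<in> hom D (omap F x) (omap F y)" if "f \<in> hom C x y" for f x y
    using F that by (auto simp: is_functor_def hom_def)
  have Fid: "amap F (Id C x) = Id D (omap F x)" if "x \<in> Obj C" for x
    using F that by (auto simp: is_functor_def)
  have Fcomp: "amap F (Comp C g f) = Comp D (amap F g) (amap F f)"
    if "f \<in> hom C x y" "g \<in> hom C y z" for f g x y z
    using F that by (auto simp: is_functor_def hom_def)
  have ivh: "iv s \<in> hom D (omap F y) (omap F x)" "Comp D (iv s) (amap F s) = Id D (omap F x)"
    "Comp D (amap F s) (iv s) = Id D (omap F y)" if "s \<in> T" "s \<in> hom C x y" for s x y
    using iv[of s] Fa[OF that(2)] that by (auto simp: inverse_arrows_def hom_def)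
  have ev_in: "zz_eval x p \<in> hom D (omap F x) (omap F y)" if "zigzag C T x p y" for x p y
    using that
  proof (induction p arbitrary: x)
    case Nil
    then show ?case using D.Id_in Fo by auto
  next
    case (Cons a p)
    show ?case
    proof (cases a)
      case (Fwd f)
      then show ?thesis
        using Cons.prems Cons.IH[of "Cod C f"] Fa[of f x "Cod C f"]
        by (auto simp: hom_def[of C] intro: D.Comp_in)
    next
      case (Bwd s)
      then show ?thesis
        using Cons.prems Cons.IH[of "Dom C s"] ivh(1)[of s "Dom C s" x]
        by (auto simp: hom_def[of C] iv_def[symmetric] intro: D.Comp_in)
    qed
  qed
  have ev_append: "zz_eval x (p @ q) = Comp D (zz_eval y q) (zz_eval x p)"
    if "zigzag C T x p y" "zigzag C T y q z" for x p y q z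
    using that(1)
  proof (induction p arbitrary: x)
    case Nil
    then show ?case using D.Id_right ev_in[OF that(2)] by auto
  next
    case (Cons a p)
    show ?case
    proof (cases a)
      case (Fwd f)
      have "zigzag C T (Cod C f) p y" "amap F f \<in> hom D (omap F x) (omap F (Cod C f))"
        using Cons.prems Fwd Fa[of f x "Cod C f"] by (auto simp: hom_def[of C])
      then show ?thesis
        using Fwd Cons.IH D.Comp_assoc[OF _ ev_in ev_in[OF that(2)]] by simp
    next
      case (Bwd s)
      have "zigzag C T (Dom C s) p y" "iv s \<in> hom D (omap F x) (omap F (Dom C s))"
        using Cons.prems Bwd ivh(1)[of s "Dom C s" x] by (auto simp: hom_def[of C])
      then show ?thesis
        using Bwd Cons.IH D.Comp_assoc[OF _ ev_in ev_in[OF that(2)]]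
        by (simp add: iv_def[symmetric])
    qed
  qed
  have ev1: "zz_eval x [Fwd f] = amap F f" if "f \<in> hom C x y" for f x y
    using that D.Id_left[OF Fa[OF that]] by (simp add: hom_def[of C])
  have ev2: "zz_eval y [Bwd s] = iv s" if "s \<in> T" "s \<in> hom C x y" for s x y
    using that D.Id_left[OF ivh(1)[OF that]] by (simp add: hom_def[of C] iv_def[symmetric])
  have zz1: "zigzag C T x [Fwd f] y" if "f \<in> hom C x y" for f x y
    using that category.Cod_in[OF C] by (auto simp: hom_def)
  have zz2: "zigzag C T y [Bwd s] x" if "s \<in> T" "s \<in> hom C x y" for s x y
    using that category.Dom_in[OF C] by (auto simp: hom_def)
  have ev_eq: "zz_eval x p = zz_eval x q" if "zz_eq C T x y p q" for x y p q
    using that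
  proof (induction rule: zz_eq.induct)
    case (append x y p q z p' q')
    then show ?case
      using zz_eq_zigzag[OF C append.hyps(1)] zz_eq_zigzag[OF C append.hyps(2)]
        ev_append[of x p y p' z] ev_append[of x q y q' z] by simp
  next
    case (comp f x y g z)
    have "zz_eval x ([Fwd f] @ [Fwd g]) = Comp D (amap F g) (amap F f)"
      using ev_append[OF zz1[OF comp(1)] zz1[OF comp(2)]] ev1[OF comp(1)] ev1[OF comp(2)] by simp
    then show ?case
      using Fcomp[OF comp] ev1[OF category.Comp_in[OF C comp]] by simp
  next
    case (ident x)
    then show ?case using ev1[OF category.Id_in[OF C ident]] Fid by simp
  next
    case (inv_right s x y)
    then show ?case
      using ev_append[OF zz1[OF inv_right(2)] zz2[OF inv_right]] ev1[OF inv_right(2)]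
        ev2[OF inv_right] ivh(2)[OF inv_right] by simp
  next
    case (inv_left s x y)
    then show ?case
      using ev_append[OF zz2[OF inv_left] zz1[OF inv_left(2)]] ev1[OF inv_left(2)]
        ev2[OF inv_left] ivh(3)[OF inv_left] by simp
  qed simp_all
  define G :: "('o, 'o \<times> 'm step list set \<times> 'o, 'p, 'n) fctr" where
    "G = \<lparr>omap = restrict (omap F) (Obj C),
      amap = restrict (\<lambda>(x, P, y). zz_eval x (SOME p. p \<in> P)) (Arr ?W)\<rparr>"
  have WO: "Obj ?W = Obj C" by (simp add: localization_def)
  have WI: "Id ?W x = zz_class C T x [] x" for x by (simp add: localization_def)
  have Ga: "amap G (zz_class C T x p y) = zz_eval x p" if "zigzag C T x p y" for x p y
  proof -
    have "zz_class C T x p y \<in> Arr ?W" using zz_class_hom[OF that] by (simp add: hom_def)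
    moreover have "zz_eq C T x y p (SOME q. zz_eq C T x y p q)"
      using zz_eq.refl[OF that] by (rule someI)
    ultimately show ?thesis
      using ev_eq[of x y p "SOME q. zz_eq C T x y p q"] by (simp add: G_def zz_class_def)
  qed
  have Wh: "\<exists>x p y. zigzag C T x p y \<and> f = zz_class C T x p y" if "f \<in> Arr ?W" for f
    using that by (auto simp: localization_def)
  have WD: "Dom ?W (zz_class C T x p y) = x" "Cod ?W (zz_class C T x p y) = y" for x p y
    by (simp_all add: localization_def zz_class_def)
  have Gf: "is_functor ?W D G"
    unfolding is_functor_def
  proof (intro conjI ballI impI)
    show "omap G \<in> Obj ?W \<rightarrow>\<^sub>E Obj D" using Fo by (auto simp: G_def WO)
    have "amap G \<in> extensional (Arr ?W)" by (simp add: G_def)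
    moreover have "amap G f \<in> Arr D" if "f \<in> Arr ?W" for f
      using Wh[OF that] Ga ev_in by (fastforce simp: hom_def)
    ultimately show "amap G \<in> Arr ?W \<rightarrow>\<^sub>E Arr D" by (auto simp: PiE_def)
  next
    fix f assume "f \<in> Arr ?W"
    then obtain x p y where *: "zigzag C T x p y" "f = zz_class C T x p y" using Wh by blast
    show "Dom D (amap G f) = omap G (Dom ?W f)" "Cod D (amap G f) = omap G (Cod ?W f)"
      using ev_in[OF *(1)] Ga[OF *(1)] zigzag_objs[OF C *(1)]
      by (simp_all add: *(2) WD G_def[THEN arg_cong, of omap] hom_def)
  next
    fix x assume "x \<in> Obj ?W"
    then show "amap G (Id ?W x) = Id D (omap G x)"
      using Ga[of x "[]" x] by (simp add: WI WO G_def[THEN arg_cong, of omap])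
  next
    fix f g assume "f \<in> Arr ?W" "g \<in> Arr ?W" and fg: "Cod ?W f = Dom ?W g"
    then obtain x p y u q z where *: "zigzag C T x p y" "f = zz_class C T x p y"
      "zigzag C T u q z" "g = zz_class C T u q z" using Wh by metis
    then have u: "u = y" using fg by (simp add: WD)
    have q: "zigzag C T y q z" using *(3) u by simp
    have "zigzag C T x (p @ q) z" using *(1) q zigzag_append[OF C] by blast
    then show "amap G (Comp ?W g f) = Comp D (amap G g) (amap G f)"
      unfolding *(2,4) u localization_Comp[OF C *(1) q]
      using Ga[OF *(1)] Ga[OF q] Ga ev_append[OF *(1) q] by simp
  qed
  have GL: "fctr_comp C G ?L = F"
  proof -
    have o: "compose (Obj C) (omap G) (omap ?L) = omap F"
    proof
      fix x show "compose (Obj C) (omap G) (omap ?L) x = omap F x"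
        using F by (cases "x \<in> Obj C")
          (auto simp: compose_def G_def localization_fctr_def is_functor_def PiE_def extensional_def)
    qed
    have a: "compose (Arr C) (amap G) (amap ?L) = amap F"
    proof
      fix f show "compose (Arr C) (amap G) (amap ?L) f = amap F f"
      proof (cases "f \<in> Arr C")
        case True
        then have h: "f \<in> hom C (Dom C f) (Cod C f)" by (simp add: hom_def)
        show ?thesis
          using True Ga[OF zz1[OF h]] ev1[OF h] by (simp add: compose_def localization_fctr_def)
      next
        case False
        then show ?thesis
          using F by (auto simp: compose_def is_functor_def PiE_def extensional_def)
      qed
    qed
    show ?thesis unfolding fctr_comp_def o a by simp
  qed
  have uniq: "H = G" if H: "is_functor ?W D H" and HL: "fctr_comp C H ?L = F" for H
  proof -
    have Ho: "omap H x = omap F x" if "x \<in> Obj C" for x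
      using HL that by (auto simp: fctr_comp_def compose_def localization_fctr_def)
    have Hf: "amap H (amap ?L f) = amap F f" if "f \<in> Arr C" for f
      using HL that by (auto simp: fctr_comp_def compose_def)
    have Hf': "amap H (zz_class C T x [Fwd f] y) = amap F f" if "f \<in> hom C x y" for f x y
      using Hf[of f] that by (auto simp: hom_def localization_fctr_def)
    have Hhom: "amap H f \<in> hom D (omap H x) (omap H y)" if "f \<in> hom ?W x y" for f x y
      using H that by (auto simp: is_functor_def hom_def)
    have Hc: "amap H (zz_class C T x (p @ q) z) =
        Comp D (amap H (zz_class C T y q z)) (amap H (zz_class C T x p y))"
      if "zigzag C T x p y" "zigzag C T y q z" for x p y q z
    proof -
      have "amap H (Comp ?W (zz_class C T y q z) (zz_class C T x p y)) =
          Comp D (amap H (zz_class C T y q z)) (amap H (zz_class C T x p y))"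
        using H zz_class_hom[OF that(1)] zz_class_hom[OF that(2)]
        by (auto simp: is_functor_def hom_def)
      then show ?thesis using localization_Comp[OF C that] by simp
    qed
    have Hi: "amap H (zz_class C T x [] x) = Id D (omap F x)" if "x \<in> Obj C" for x
    proof -
      have "amap H (Id ?W x) = Id D (omap H x)" using H that by (auto simp: is_functor_def WO)
      then show ?thesis using Ho[OF that] by (simp add: WI)
    qed
    have Hb: "amap H (zz_class C T y [Bwd s] x) = iv s" if s: "s \<in> T" "s \<in> hom C x y" for s x y
    proof -
      let ?b = "amap H (zz_class C T y [Bwd s] x)"
      have ox: "x \<in> Obj C" "y \<in> Obj C" using zigzag_objs[OF C zz1[OF s(2)]] by auto
      have bh: "?b \<in> hom D (omap F y) (omap F x)"
        using Hhom[OF zz_class_hom[OF zz2[OF s]]] Ho ox by simp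
      have "zz_class C T x ([Fwd s] @ [Bwd s]) x = zz_class C T x [] x"
        using zz_eq.inv_right[OF s] zz_eq_zigzag[OF C zz_eq.inv_right[OF s]]
        by (simp add: zz_class_eq_iff)
      then have bs: "Comp D ?b (amap F s) = Id D (omap F x)"
        using Hc[OF zz1[OF s(2)] zz2[OF s]] Hf'[OF s(2)] Hi[OF ox(1)] by simp
      have "?b = Comp D ?b (Comp D (amap F s) (iv s))"
        using ivh(3)[OF s] D.Id_right[OF bh] by simp
      also have "\<dots> = Comp D (Comp D ?b (amap F s)) (iv s)"
        using D.Comp_assoc[OF ivh(1)[OF s] Fa[OF s(2)] bh] by simp
      also have "\<dots> = iv s" using bs D.Id_left[OF ivh(1)[OF s]] by simp
      finally show ?thesis .
    qed
    have Hev: "amap H (zz_class C T x p y) = zz_eval x p" if "zigzag C T x p y" for x p y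
      using that
    proof (induction p arbitrary: x)
      case Nil
      then show ?case using Hi by auto
    next
      case (Cons a p)
      show ?case
      proof (cases a)
        case (Fwd f)
        then have f: "f \<in> hom C x (Cod C f)" and p: "zigzag C T (Cod C f) p y"
          using Cons.prems by (auto simp: hom_def)
        show ?thesis using Hc[OF zz1[OF f] p] Hf'[OF f] Cons.IH[OF p] Fwd by simp
      next
        case (Bwd s)
        then have s: "s \<in> T" "s \<in> hom C (Dom C s) x" and p: "zigzag C T (Dom C s) p y"
          using Cons.prems by (auto simp: hom_def)
        show ?thesis using Hc[OF zz2[OF s] p] Hb[OF s] Cons.IH[OF p] Bwd
          by (simp add: iv_def[symmetric])
      qed
    qed
    have "omap H = omap G"
    proof
      fix x show "omap H x = omap G x"
        using H Ho by (cases "x \<in> Obj C")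
          (auto simp: G_def is_functor_def PiE_def extensional_def WO)
    qed
    moreover have "amap H = amap G"
    proof
      fix f show "amap H f = amap G f"
      proof (cases "f \<in> Arr ?W")
        case True
        then show ?thesis using Wh[OF True] Hev Ga by auto
      next
        case False
        then show ?thesis
          using H PiE_arb[of "amap H" "Arr ?W" "\<lambda>_. Arr D" f]
          by (simp add: G_def is_functor_def)
      qed
    qed
    ultimately show ?thesis by simp
  qed
  show ?thesis using Gf GL uniq by blast
qed

end

end

theory Submission
  imports Defs
begin

text \<open>The intersection of all \<open>\<kappa>\<close>-closed monoidal multiplicative systems \<open>T'\<close> containing \<open>S\<close> has
  no reason to be a multiplicative system: the completing arrow \<open>t\<close> in the Ore and cancellation
  conditions may depend on \<open>T'\<close>. This is repaired by enlarging each \<open>T'\<close> to its saturation,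
  the arrows \<open>f\<close> for which some \<open>g f\<close> and some \<open>f h\<close> lie in \<open>T'\<close>. These are the arrows that
  become invertible in \<open>V[T'\<^sup>-\<^sup>1]\<close>, but working with the elementary description avoids any
  analysis of equality of zigzags. For a saturation the completing arrows can be chosen uniformly:
  it is closed under pushouts, and it contains the coequalizer of any two arrows that are equalized
  by one of its members (\<open>saturation_pushout\<close>, \<open>saturation_coequalizer\<close>). Both reflect the fact
  that a localization with a calculus of fractions preserves finite colimits. The dual
  statements hold as well, because the definition of the saturation is self-dual.

  Hence the intersection \<open>T\<close> of the saturations is a multiplicative system. Closure under
  \<open>\<kappa>\<close>-small products and coproducts and under tensoring passes from \<open>T'\<close> to its saturation by
  applying the operation to the witnesses \<open>g\<close> and \<open>h\<close>, and from there to the intersection.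
  Finally, \<open>V \<rightarrow> V[T'\<^sup>-\<^sup>1]\<close> inverts the saturation of \<open>T'\<close>, so it inverts \<open>T\<close>, and the universal
  property of \<open>V[T\<^sup>-\<^sup>1]\<close> gives the unique factorization.\<close>

section \<open>Categories, duality and isomorphisms\<close>

lemma hom_op_cat [simp]: "hom (op_cat C) x y = hom C y x"
  by (auto simp: hom_def op_cat_def)

lemma op_cat_sel [simp]:
  "Obj (op_cat C) = Obj C" "Arr (op_cat C) = Arr C" "Dom (op_cat C) = Cod C"
  "Cod (op_cat C) = Dom C" "Id (op_cat C) = Id C" "Comp (op_cat C) g f = Comp C f g"
  by (simp_all add: op_cat_def)

lemma category_op_cat:
  assumes "category C"
  shows "category (op_cat C)"
proof -
  interpret category C by fact
  show ?thesis
    by unfold_locales (simp_all add: Dom_in Cod_in Id_in Comp_in Id_left Id_right Comp_assoc)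
qed

lemma (in category) hom_objs:
  assumes "f \<in> hom C x y"
  shows "x \<in> Obj C" "y \<in> Obj C"
  using assms Dom_in Cod_in by (auto simp: hom_def)

text \<open>\<open>f\<close> has the left inverse \<open>(g f)\<^sup>-\<^sup>1 g\<close> and the right inverse \<open>h (f h)\<^sup>-\<^sup>1\<close>, which
  then coincide.\<close>

lemma (in category) is_iso_if_composites_iso:
  assumes f: "f \<in> hom C x y" and g: "g \<in> hom C y z" and h: "h \<in> hom C w x"
    and gf: "is_iso C (g \<cdot> f)" and fh: "is_iso C (f \<cdot> h)"
  shows "is_iso C f"
proof -
  have gfh: "g \<cdot> f \<in> hom C x z" "f \<cdot> h \<in> hom C w y"
    using Comp_in f g h by blast+
  obtain a where a: "a \<in> hom C z x" "a \<cdot> (g \<cdot> f) = Id C x"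
    using gf gfh(1) by (auto simp: is_iso_def inverse_arrows_def hom_def)
  obtain b where b: "b \<in> hom C y w" "(f \<cdot> h) \<cdot> b = Id C y"
    using fh gfh(2) by (auto simp: is_iso_def inverse_arrows_def hom_def)
  have ag: "a \<cdot> g \<in> hom C y x" and hb: "h \<cdot> b \<in> hom C y x"
    using Comp_in a b g h by blast+
  have l: "(a \<cdot> g) \<cdot> f = Id C x" using a Comp_assoc[OF f g a(1)] by simp
  have r: "f \<cdot> (h \<cdot> b) = Id C y" using b Comp_assoc[OF b(1) h f] by simp
  have "h \<cdot> b = ((a \<cdot> g) \<cdot> f) \<cdot> (h \<cdot> b)" using l Id_left[OF hb] by simp
  also have "\<dots> = a \<cdot> g" using Comp_assoc[OF hb f ag] r Id_right[OF ag] by simp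
  finally have "f \<cdot> (a \<cdot> g) = Id C y" using r by simp
  then show ?thesis
    using f ag l unfolding is_iso_def inverse_arrows_def by (auto simp: hom_def)
qed

section \<open>Limits of bipartite diagrams\<close>

text \<open>Products, equalizers and pullbacks are all limits over a graph in which no two edges are
  composable. Such a graph becomes a category by adding identities only; a vertex serves as
  its own identity, and one of two composable arrows is always an identity.\<close>

lemma bipartite_limit:
  fixes C :: "('o, 'm, 'z) cat_scheme" and N E :: "'u set"
  assumes C: "category C" and complete: "complete_category TYPE('u) C"
    and small: "|N \<union> E| <o |UNIV :: 'u set|" and disj: "N \<inter> E = {}"
    and src: "\<forall>e\<in>E. src e \<in> N" and tgt: "\<forall>e\<in>E. tgt e \<in> N"
    and bipartite: "\<forall>e\<in>E. \<forall>e'\<in>E. tgt e \<noteq> src e'"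
    and X: "\<forall>n\<in>N. X n \<in> Obj C"
    and \<phi>: "\<forall>e\<in>E. \<phi> e \<in> hom C (X (src e)) (X (tgt e))"
  shows "\<exists>p \<pi>. p \<in> Obj C \<and> (\<forall>n\<in>N. \<pi> n \<in> hom C p (X n)) \<and>
    (\<forall>e\<in>E. Comp C (\<phi> e) (\<pi> (src e)) = \<pi> (tgt e)) \<and>
    (\<forall>y \<psi>. y \<in> Obj C \<and> (\<forall>n\<in>N. \<psi> n \<in> hom C y (X n)) \<and>
       (\<forall>e\<in>E. Comp C (\<phi> e) (\<psi> (src e)) = \<psi> (tgt e)) \<longrightarrow>
       (\<exists>!h. h \<in> hom C y p \<and> (\<forall>n\<in>N. Comp C (\<pi> n) h = \<psi> n)))"
proof -
  interpret category C by fact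
  define J :: "('u, 'u) cat" where "J = \<lparr>Obj = N, Arr = N \<union> E,
    Dom = (\<lambda>a. if a \<in> E then src a else a), Cod = (\<lambda>a. if a \<in> E then tgt a else a),
    Id = (\<lambda>n. n), Comp = (\<lambda>b a. if b \<in> E then b else a)\<rparr>"
  define D :: "('u, 'u, 'o, 'm) fctr" where "D = \<lparr>omap = restrict X N,
    amap = restrict (\<lambda>a. if a \<in> E then \<phi> a else Id C (X a)) (N \<union> E)\<rparr>"
  have NE: "n \<notin> E" if "n \<in> N" for n using disj that by auto
  have bip: False if "src e' = tgt e" "e \<in> E" "e' \<in> E" for e e'
    using bipartite that by metis
  have J: "category J"
    by unfold_locales (use src tgt bipartite bip NE in \<open>auto simp: J_def hom_def split: if_splits\<close>)
  have Dh: "amap D a \<in> hom C (omap D (Dom J a)) (omap D (Cod J a))" if "a \<in> Arr J" for a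
    using that src tgt \<phi> Id_in X by (auto simp: J_def D_def)
  have D: "is_functor J C D"
    unfolding is_functor_def
  proof (intro conjI ballI impI)
    show "omap D \<in> Obj J \<rightarrow>\<^sub>E Obj C" using X by (auto simp: J_def D_def)
    have "amap D \<in> extensional (Arr J)" by (simp add: J_def D_def)
    then show "amap D \<in> Arr J \<rightarrow>\<^sub>E Arr C" using Dh by (auto simp: PiE_def hom_def)
  next
    fix a assume "a \<in> Arr J"
    then show "Dom C (amap D a) = omap D (Dom J a)" "Cod C (amap D a) = omap D (Cod J a)"
      using Dh by (auto simp: hom_def)
  next
    fix x assume "x \<in> Obj J"
    then show "amap D (Id J x) = Id C (omap D x)" using NE by (auto simp: J_def D_def)
  next
    fix a b assume ab: "a \<in> Arr J" "b \<in> Arr J" "Cod J a = Dom J b"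
    show "amap D (Comp J b a) = Comp C (amap D b) (amap D a)"
    proof (cases "b \<in> E")
      case True
      then have "a \<in> N" "a = src b" using ab bipartite by (auto simp: J_def split: if_splits)
      then show ?thesis
        using True NE src Id_right[OF \<phi>[rule_format, OF True]] by (auto simp: J_def D_def)
    next
      case False
      then have "Id C (omap D (Cod J a)) = amap D b" using ab by (auto simp: J_def D_def)
      then show ?thesis using False Id_left[OF Dh[OF ab(1)]] by (simp add: J_def)
    qed
  qed
  have cone: "is_cone J C D y \<psi> \<longleftrightarrow> y \<in> Obj C \<and> (\<forall>n\<in>N. \<psi> n \<in> hom C y (X n)) \<and>
      (\<forall>e\<in>E. Comp C (\<phi> e) (\<psi> (src e)) = \<psi> (tgt e))" for y \<psi>
  proof -
    have "Comp C (amap D n) (\<psi> (Dom J n)) = \<psi> (Cod J n)"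
      if "n \<in> N" "\<psi> n \<in> hom C y (X n)" for n
      using that NE Id_left by (auto simp: J_def D_def)
    moreover have "amap D e = \<phi> e \<and> Dom J e = src e \<and> Cod J e = tgt e" if "e \<in> E" for e
      using that by (auto simp: J_def D_def)
    moreover have "Obj J = N" "Arr J = N \<union> E" "\<And>n. n \<in> N \<Longrightarrow> omap D n = X n"
      by (auto simp: J_def D_def)
    ultimately show ?thesis unfolding is_cone_def by (auto simp: ball_Un)
  qed
  have "|Arr J| <o |UNIV :: 'u set|" using small by (simp add: J_def)
  then obtain p \<pi> where "is_limit_cone J C D p \<pi>"
    using complete J D unfolding complete_category_def by blast
  moreover have "Obj J = N" by (simp add: J_def)
  ultimately show ?thesis unfolding is_limit_cone_def cone by auto
qed

lemma products_exist:
  fixes I :: "'u set"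
  assumes "category C" "complete_category TYPE('u) C" "|I| <o |UNIV :: 'u set|"
    and "\<And>i. i \<in> I \<Longrightarrow> X i \<in> Obj C"
  shows "\<exists>p \<pi>. is_product C I X p \<pi>"
proof -
  obtain p \<pi> where "p \<in> Obj C" "\<forall>i\<in>I. \<pi> i \<in> hom C p (X i)"
    "\<And>y \<psi>. \<lbrakk>y \<in> Obj C; \<forall>i\<in>I. \<psi> i \<in> hom C y (X i)\<rbrakk> \<Longrightarrow>
      \<exists>!h. h \<in> hom C y p \<and> (\<forall>i\<in>I. Comp C (\<pi> i) h = \<psi> i)"
    using bipartite_limit[of C I "{}" _ _ X] assms by auto
  then show ?thesis unfolding is_product_def by blast
qed

lemma infinite_obtains_five_distinct:
  assumes "infinite (UNIV :: 'u set)"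
  obtains a b c d e :: 'u where "distinct [a, b, c, d, e]"
proof -
  obtain B :: "'u set" where "finite B" "card B = 5"
    using infinite_arbitrarily_large[OF assms] by blast
  then obtain xs where "set xs = B" "distinct xs" "length xs = 5"
    using finite_distinct_list distinct_card by metis
  then show thesis
    using that by (auto simp: length_Suc_conv numeral_eq_Suc)
qed

text \<open>The value of a cone at the common codomain is determined by the other two, so the
  universal property can be stated without it; likewise for equalizers below.\<close>

lemma pullbacks_exist:
  fixes C :: "('o, 'm, 'z) cat_scheme" (structure)
  assumes C: "category C" and complete: "complete_category TYPE('u) C"
    and inf: "infinite (UNIV :: 'u set)"
    and f: "f \<in> hom C x z" and g: "g \<in> hom C y z"
  shows "\<exists>p a b. a \<in> hom C p x \<and> b \<in> hom C p y \<and> Comp C f a = Comp C g b \<and>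
    (\<forall>w u v. u \<in> hom C w x \<and> v \<in> hom C w y \<and> Comp C f u = Comp C g v \<longrightarrow>
      (\<exists>!h. h \<in> hom C w p \<and> Comp C a h = u \<and> Comp C b h = v))"
proof -
  interpret category C by fact
  obtain n1 n2 n3 e1 e2 :: 'u where d: "distinct [n1, n2, n3, e1, e2]"
    using infinite_obtains_five_distinct[OF inf] .
  define X where "X n = (if n = n1 then x else if n = n2 then y else z)" for n
  define \<phi> where "\<phi> e = (if e = e1 then f else g)" for e
  define src where "src e = (if e = e1 then n1 else n2)" for e
  have small: "|{n1, n2, n3} \<union> {e1, e2}| <o |UNIV :: 'u set|"
    by (rule finite_ordLess_infinite) (use inf in \<open>auto simp: Field_card_of card_of_well_order_on\<close>)
  note o = hom_objs[OF f] hom_objs[OF g]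
  have 1: "{n1, n2, n3} \<inter> {e1, e2} = {}" using d by auto
  have 2: "\<forall>e\<in>{e1, e2}. src e \<in> {n1, n2, n3}" and 3: "\<forall>e\<in>{e1, e2}. n3 \<in> {n1, n2, n3}"
    by (simp_all add: src_def)
  have 4: "\<forall>e\<in>{e1, e2}. \<forall>e'\<in>{e1, e2}. n3 \<noteq> src e'"
    using d by (auto simp: src_def)
  have 5: "\<forall>n\<in>{n1, n2, n3}. X n \<in> Obj C" using o by (simp add: X_def)
  have 6: "\<forall>e\<in>{e1, e2}. \<phi> e \<in> hom C (X (src e)) (X n3)"
    using d f g by (auto simp: X_def \<phi>_def src_def)
  obtain p \<pi> where p: "p \<in> Obj C" "\<forall>n\<in>{n1, n2, n3}. \<pi> n \<in> hom C p (X n)"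
    "\<forall>e\<in>{e1, e2}. Comp C (\<phi> e) (\<pi> (src e)) = \<pi> n3"
    and u: "\<forall>y \<psi>. y \<in> Obj C \<and> (\<forall>n\<in>{n1, n2, n3}. \<psi> n \<in> hom C y (X n)) \<and>
       (\<forall>e\<in>{e1, e2}. Comp C (\<phi> e) (\<psi> (src e)) = \<psi> n3) \<longrightarrow>
       (\<exists>!h. h \<in> hom C y p \<and> (\<forall>n\<in>{n1, n2, n3}. Comp C (\<pi> n) h = \<psi> n))"
    using bipartite_limit[where src = src and tgt = "\<lambda>_. n3" and \<phi> = \<phi>,
        OF C complete small 1 2 3 4 5 6] by blast
  have \<pi>: "\<pi> n1 \<in> hom C p x" "\<pi> n2 \<in> hom C p y" "f \<cdot> \<pi> n1 = \<pi> n3" "g \<cdot> \<pi> n2 = \<pi> n3"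
    using p d by (auto simp: X_def \<phi>_def src_def)
  have "\<exists>!h. h \<in> hom C w p \<and> \<pi> n1 \<cdot> h = r \<and> \<pi> n2 \<cdot> h = s"
    if r: "r \<in> hom C w x" and s: "s \<in> hom C w y" and e: "f \<cdot> r = g \<cdot> s" for w r s
  proof -
    define \<psi> where "\<psi> n = (if n = n1 then r else if n = n2 then s else f \<cdot> r)" for n
    have "\<exists>!h. h \<in> hom C w p \<and> (\<forall>n\<in>{n1, n2, n3}. Comp C (\<pi> n) h = \<psi> n)"
      by (rule u[rule_format]) (use hom_objs[OF r] r s e Comp_in[OF r f] d in
          \<open>auto simp: \<psi>_def X_def \<phi>_def src_def\<close>)
    moreover have "(\<forall>n\<in>{n1, n2, n3}. Comp C (\<pi> n) h = \<psi> n) \<longleftrightarrow> \<pi> n1 \<cdot> h = r \<and> \<pi> n2 \<cdot> h = s"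
      if "h \<in> hom C w p" for h
      using d Comp_assoc[OF that \<pi>(1) f] \<pi>(3) by (auto simp: \<psi>_def)
    ultimately show ?thesis by (auto cong: conj_cong)
  qed
  then show ?thesis using \<pi> by metis
qed

lemma equalizers_exist:
  fixes C :: "('o, 'm, 'z) cat_scheme" (structure)
  assumes C: "category C" and complete: "complete_category TYPE('u) C"
    and inf: "infinite (UNIV :: 'u set)"
    and f: "f \<in> hom C x y" and g: "g \<in> hom C x y"
  shows "\<exists>p a. a \<in> hom C p x \<and> Comp C f a = Comp C g a \<and>
    (\<forall>w u. u \<in> hom C w x \<and> Comp C f u = Comp C g u \<longrightarrow>
      (\<exists>!h. h \<in> hom C w p \<and> Comp C a h = u))"
proof -
  interpret category C by fact
  obtain n1 n2 n3 e1 e2 :: 'u where d: "distinct [n1, n2, n3, e1, e2]"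
    using infinite_obtains_five_distinct[OF inf] .
  define X where "X n = (if n = n1 then x else y)" for n
  define \<phi> where "\<phi> e = (if e = e1 then f else g)" for e
  have small: "|{n1, n2} \<union> {e1, e2}| <o |UNIV :: 'u set|"
    by (rule finite_ordLess_infinite) (use inf in \<open>auto simp: Field_card_of card_of_well_order_on\<close>)
  note o = hom_objs[OF f]
  have 1: "{n1, n2} \<inter> {e1, e2} = {}" using d by auto
  have 2: "\<forall>e\<in>{e1, e2}. n1 \<in> {n1, n2}" and 3: "\<forall>e\<in>{e1, e2}. n2 \<in> {n1, n2}" by simp_all
  have 4: "\<forall>e\<in>{e1, e2}. \<forall>e'\<in>{e1, e2}. n2 \<noteq> n1" using d by auto
  have 5: "\<forall>n\<in>{n1, n2}. X n \<in> Obj C" using o by (simp add: X_def)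
  have 6: "\<forall>e\<in>{e1, e2}. \<phi> e \<in> hom C (X n1) (X n2)"
    using d f g by (auto simp: X_def \<phi>_def)
  obtain p \<pi> where p: "p \<in> Obj C" "\<forall>n\<in>{n1, n2}. \<pi> n \<in> hom C p (X n)"
    "\<forall>e\<in>{e1, e2}. Comp C (\<phi> e) (\<pi> n1) = \<pi> n2"
    and u: "\<forall>y \<psi>. y \<in> Obj C \<and> (\<forall>n\<in>{n1, n2}. \<psi> n \<in> hom C y (X n)) \<and>
       (\<forall>e\<in>{e1, e2}. Comp C (\<phi> e) (\<psi> n1) = \<psi> n2) \<longrightarrow>
       (\<exists>!h. h \<in> hom C y p \<and> (\<forall>n\<in>{n1, n2}. Comp C (\<pi> n) h = \<psi> n))"
    using bipartite_limit[where src = "\<lambda>_. n1" and tgt = "\<lambda>_. n2" and \<phi> = \<phi>,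
        OF C complete small 1 2 3 4 5 6] by blast
  have \<pi>: "\<pi> n1 \<in> hom C p x" "f \<cdot> \<pi> n1 = \<pi> n2" "g \<cdot> \<pi> n1 = \<pi> n2"
    using p d by (auto simp: X_def \<phi>_def)
  have "\<exists>!h. h \<in> hom C w p \<and> \<pi> n1 \<cdot> h = r"
    if r: "r \<in> hom C w x" and e: "f \<cdot> r = g \<cdot> r" for w r
  proof -
    define \<psi> where "\<psi> n = (if n = n1 then r else f \<cdot> r)" for n
    have "\<exists>!h. h \<in> hom C w p \<and> (\<forall>n\<in>{n1, n2}. Comp C (\<pi> n) h = \<psi> n)"
      by (rule u[rule_format]) (use hom_objs[OF r] r e Comp_in[OF r f] d in
          \<open>auto simp: \<psi>_def X_def \<phi>_def\<close>)
    moreover have "(\<forall>n\<in>{n1, n2}. Comp C (\<pi> n) h = \<psi> n) \<longleftrightarrow> \<pi> n1 \<cdot> h = r"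
      if "h \<in> hom C w p" for h
      using d Comp_assoc[OF that \<pi>(1) f] \<pi>(2) by (auto simp: \<psi>_def)
    ultimately show ?thesis by (auto cong: conj_cong)
  qed
  then show ?thesis using \<pi> by metis
qed

section \<open>Calculus of fractions\<close>

lemma right_multiplicative_systemD:
  assumes "right_multiplicative_system C S"
  shows "S \<subseteq> Arr C"
    and "x \<in> Obj C \<Longrightarrow> Id C x \<in> S"
    and "\<lbrakk>s \<in> S; t \<in> S; s \<in> hom C x y; t \<in> hom C y z\<rbrakk> \<Longrightarrow> Comp C t s \<in> S"
    and "\<lbrakk>f \<in> hom C x y; s \<in> S; s \<in> hom C x x'\<rbrakk> \<Longrightarrow>
      \<exists>z f' t. f' \<in> hom C x' z \<and> t \<in> S \<and> t \<in> hom C y z \<and> Comp C f' s = Comp C t f"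
    and "\<lbrakk>g1 \<in> hom C x y; g2 \<in> hom C x y; s \<in> S; s \<in> hom C w x; Comp C g1 s = Comp C g2 s\<rbrakk> \<Longrightarrow>
      \<exists>z t. t \<in> S \<and> t \<in> hom C y z \<and> Comp C t g1 = Comp C t g2"
proof -
  note * = assms[unfolded right_multiplicative_system_def]
  show S: "S \<subseteq> Arr C" using * by blast
  show "x \<in> Obj C \<Longrightarrow> Id C x \<in> S" using * by blast
  show "\<lbrakk>s \<in> S; t \<in> S; s \<in> hom C x y; t \<in> hom C y z\<rbrakk> \<Longrightarrow> Comp C t s \<in> S"
    using * by (simp add: hom_def)
  show "\<exists>z f' t. f' \<in> hom C x' z \<and> t \<in> S \<and> t \<in> hom C y z \<and> Comp C f' s = Comp C t f"
    if fs: "f \<in> hom C x y" "s \<in> S" "s \<in> hom C x x'"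
  proof -
    have "f \<in> Arr C" "Dom C f = Dom C s" using that by (auto simp: hom_def)
    then obtain f2 t where "f2 \<in> Arr C" "t \<in> S" "Dom C f2 = Cod C s" "Dom C t = Cod C f"
        "Cod C f2 = Cod C t" "Comp C f2 s = Comp C t f"
      using * fs(2) by blast
    then have "f2 \<in> hom C x' (Cod C t)" "t \<in> hom C y (Cod C t)"
      using fs S by (auto simp: hom_def)
    then show ?thesis using \<open>t \<in> S\<close> \<open>Comp C f2 s = Comp C t f\<close> by blast
  qed
  show "\<exists>z t. t \<in> S \<and> t \<in> hom C y z \<and> Comp C t g1 = Comp C t g2"
    if gs: "g1 \<in> hom C x y" "g2 \<in> hom C x y" "s \<in> S" "s \<in> hom C w x" "Comp C g1 s = Comp C g2 s"
  proof -
    have "Cod C s = x" using gs by (auto simp: hom_def)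
    then obtain t where "t \<in> S" "Dom C t = y" "Comp C t g1 = Comp C t g2"
      using * gs by blast
    moreover from this have "t \<in> hom C y (Cod C t)" using S by (auto simp: hom_def)
    ultimately show ?thesis by blast
  qed
qed

text \<open>As multiplicative systems are two-sided, every statement that uses only right fractions
  yields one about left fractions by passing to the opposite category.\<close>

lemma multiplicative_system_op_cat:
  "multiplicative_system (op_cat C) S \<longleftrightarrow> multiplicative_system C S"
proof -
  have "right_multiplicative_system (op_cat (op_cat C)) S \<longleftrightarrow> right_multiplicative_system C S"
    unfolding right_multiplicative_system_def by simp
  then show ?thesis
    unfolding multiplicative_system_def left_multiplicative_system_def by blast
qed

text \<open>For a multiplicative system this is the class of all arrows inverted by the localization:
  \<open>g\<close> and \<open>h\<close> witness a left and a right inverse.\<close>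

definition saturation :: "('o, 'm, 'z) cat_scheme \<Rightarrow> 'm set \<Rightarrow> 'm set" where
  "saturation C S = {f \<in> Arr C. (\<exists>g\<in>Arr C. Dom C g = Cod C f \<and> Comp C g f \<in> S) \<and>
     (\<exists>h\<in>Arr C. Cod C h = Dom C f \<and> Comp C f h \<in> S)}"

lemma saturation_op_cat: "saturation (op_cat C) S = saturation C S"
  unfolding saturation_def by auto

lemma saturationI:
  assumes "f \<in> hom C x y" "g \<in> hom C y z" "Comp C g f \<in> S" "h \<in> hom C w x" "Comp C f h \<in> S"
  shows "f \<in> saturation C S"
  using assms unfolding saturation_def hom_def by blast

lemma saturationE:
  assumes "f \<in> saturation C S" "f \<in> hom C x y"
  obtains g z h w where "g \<in> hom C y z" "Comp C g f \<in> S" "h \<in> hom C w x" "Comp C f h \<in> S"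
  using assms unfolding saturation_def hom_def by blast

context category
begin

lemma subset_saturation:
  assumes "multiplicative_system C S"
  shows "S \<subseteq> saturation C S"
proof
  fix s assume s: "s \<in> S"
  have "S \<subseteq> Arr C"
    using assms right_multiplicative_systemD(1)[of C S] by (simp add: multiplicative_system_def)
  then have h: "s \<in> hom C (Dom C s) (Cod C s)" using s by (auto simp: hom_def)
  show "s \<in> saturation C S"
    using saturationI[OF h Id_in[OF hom_objs(2)[OF h]] _ Id_in[OF hom_objs(1)[OF h]], of S]
      s Id_left[OF h] Id_right[OF h] by simp
qed

lemma is_iso_if_saturation:
  assumes D: "category D" and F: "is_functor C D F"
    and T: "\<And>s. s \<in> T \<Longrightarrow> is_iso D (amap F s)" and f: "f \<in> saturation C T"
  shows "is_iso D (amap F f)"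
proof -
  have h: "f \<in> hom C (Dom C f) (Cod C f)" using f by (simp add: saturation_def hom_def)
  obtain g z k w where *: "g \<in> hom C (Cod C f) z" "g \<cdot> f \<in> T" "k \<in> hom C w (Dom C f)" "f \<cdot> k \<in> T"
    using saturationE[OF f h] .
  have Fh: "amap F a \<in> hom D (omap F x) (omap F y)" if "a \<in> hom C x y" for a x y
    using F that by (auto simp: is_functor_def hom_def)
  have "amap F (b \<cdot> a) = Comp D (amap F b) (amap F a)" if "a \<in> hom C x y" "b \<in> hom C y z" for a b x y z
    using F that by (auto simp: is_functor_def hom_def)
  from this[OF h *(1)] this[OF *(3) h] show ?thesis
    using category.is_iso_if_composites_iso[OF D Fh[OF h] Fh[OF *(1)] Fh[OF *(3)]] T[OF *(2)] T[OF *(4)]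
    by simp
qed

text \<open>In the localization \<open>g\<close> has a left and a right inverse, so it is invertible, and so is
  \<open>f\<close>. Elementarily, the Ore condition of left fractions for \<open>g f\<close> and \<open>g\<close> gives \<open>h\<close> and
  \<open>t \<in> S\<close> with \<open>g f h = g t\<close>, and \<open>k g \<in> S\<close> allows \<open>g\<close> to be cancelled after
  precomposition with some \<open>u \<in> S\<close>. This converts witnesses on one side, which colimits
  provide, into the two-sided ones that membership in the saturation requires.\<close>

lemma ex_precomposite_if_ex_postcomposites:
  assumes S: "multiplicative_system C S"
    and f: "f \<in> hom C x y" and g: "g \<in> hom C y z" and k: "k \<in> hom C z w"
    and gf: "g \<cdot> f \<in> S" and kg: "k \<cdot> g \<in> S"
  shows "\<exists>v h. h \<in> hom C v x \<and> f \<cdot> h \<in> S"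
proof -
  have L: "right_multiplicative_system (op_cat C) S"
    using S by (simp add: multiplicative_system_def left_multiplicative_system_def)
  note L = right_multiplicative_systemD[OF L, simplified]
  obtain v h t where h: "h \<in> hom C v x" "t \<in> S" "t \<in> hom C v y" "(g \<cdot> f) \<cdot> h = g \<cdot> t"
    using L(4)[OF g gf Comp_in[OF f g]] by metis
  have fh: "f \<cdot> h \<in> hom C v y" using Comp_in[OF h(1) f] .
  have "(k \<cdot> g) \<cdot> (f \<cdot> h) = (k \<cdot> g) \<cdot> t"
    using Comp_assoc[OF fh g k] Comp_assoc[OF h(3) g k] Comp_assoc[OF h(1) f g] h(4) by simp
  then obtain v' u where u: "u \<in> S" "u \<in> hom C v' v" "(f \<cdot> h) \<cdot> u = t \<cdot> u"
    using L(5)[OF fh h(3) kg Comp_in[OF g k]] by blast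
  have "t \<cdot> u \<in> S" using L(3) u h by blast
  then have "f \<cdot> (h \<cdot> u) \<in> S" using u(3) Comp_assoc[OF u(2) h(1) f] by simp
  then show ?thesis using Comp_in[OF u(2) h(1)] by blast
qed

text \<open>The Ore condition for \<open>g' g \<in> S\<close> and \<open>f'\<close> moves the witness of \<open>f\<close> past that of \<open>g\<close>.
  Its dual gives the other half of closure of the saturation under composition.\<close>

lemma ex_postcomposite_Comp:
  assumes S: "right_multiplicative_system C S"
    and f: "f \<in> hom C x y" and g: "g \<in> hom C y z"
    and f': "f' \<in> hom C y u" "f' \<cdot> f \<in> S" and g': "g' \<in> hom C z v" "g' \<cdot> g \<in> S"
  shows "\<exists>w k. k \<in> hom C z w \<and> k \<cdot> (g \<cdot> f) \<in> S"
proof -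
  note R = right_multiplicative_systemD[OF S]
  obtain w k t where k: "k \<in> hom C v w" "t \<in> S" "t \<in> hom C u w" "k \<cdot> (g' \<cdot> g) = t \<cdot> f'"
    using R(4)[OF f'(1) g'(2) Comp_in[OF g g'(1)]] by blast
  have "(k \<cdot> g') \<cdot> (g \<cdot> f) = ((k \<cdot> g') \<cdot> g) \<cdot> f"
    using Comp_assoc[OF f g Comp_in[OF g'(1) k(1)]] by simp
  also have "\<dots> = (t \<cdot> f') \<cdot> f" using Comp_assoc[OF g g'(1) k(1)] k(4) by simp
  also have "\<dots> = t \<cdot> (f' \<cdot> f)" using Comp_assoc[OF f f'(1) k(3)] .
  also have "\<dots> \<in> S" using R(3)[OF f'(2) k(2) Comp_in[OF f f'(1)] k(3)] .
  finally show ?thesis using Comp_in[OF g'(1) k(1)] by blast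
qed

lemma saturation_Comp:
  assumes S: "multiplicative_system C S"
    and f: "f \<in> saturation C S" "f \<in> hom C x y" and g: "g \<in> saturation C S" "g \<in> hom C y z"
  shows "g \<cdot> f \<in> saturation C S"
proof -
  have R: "right_multiplicative_system C S" and L: "right_multiplicative_system (op_cat C) S"
    using S by (simp_all add: multiplicative_system_def left_multiplicative_system_def)
  interpret op: category "op_cat C" by (rule category_op_cat) unfold_locales
  obtain f1 u f2 v where F: "f1 \<in> hom C y u" "f1 \<cdot> f \<in> S" "f2 \<in> hom C v x" "f \<cdot> f2 \<in> S"
    using saturationE[OF f] .
  obtain g1 u' g2 v' where G: "g1 \<in> hom C z u'" "g1 \<cdot> g \<in> S" "g2 \<in> hom C v' y" "g \<cdot> g2 \<in> S"
    using saturationE[OF g] .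
  show ?thesis
    using ex_postcomposite_Comp[OF R f(2) g(2) F(1,2) G(1,2)]
      op.ex_postcomposite_Comp[OF L, simplified, OF g(2) f(2) G(3,4) F(3,4)]
      saturationI[OF Comp_in[OF f(2) g(2)]] by blast
qed

text \<open>An arrow \<open>g\<close> with \<open>g f \<in> S\<close> and the Ore condition yield \<open>m\<close> with \<open>m c \<in> S\<close>. It remains
  to find an arrow whose composite with \<open>m\<close> is in \<open>S\<close>, so that \<open>ex_precomposite_if_ex_postcomposites\<close> applies. The Ore
  condition for \<open>m c\<close> and \<open>c\<close> gives \<open>k\<close> and \<open>s \<in> S\<close> with \<open>k m c = s c\<close>. The arrows \<open>k m\<close>
  and \<open>s\<close> thus agree on the leg \<open>c\<close> of the pushout; on the leg \<open>b\<close> they agree after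
  precomposition with \<open>f h \<in> S\<close>, hence after postcomposition with some \<open>t' \<in> S\<close>. By
  uniqueness of induced arrows \<open>t' k m = t' s \<in> S\<close>.\<close>

lemma saturation_pushout:
  assumes S: "multiplicative_system C S"
    and f: "f \<in> saturation C S" "f \<in> hom C x y" and a: "a \<in> hom C x z"
    and b: "b \<in> hom C y q" and c: "c \<in> hom C z q" and sq: "b \<cdot> f = c \<cdot> a"
    and univ: "\<And>w u v. \<lbrakk>u \<in> hom C y w; v \<in> hom C z w; u \<cdot> f = v \<cdot> a\<rbrakk> \<Longrightarrow>
      \<exists>!h. h \<in> hom C q w \<and> h \<cdot> b = u \<and> h \<cdot> c = v"
  shows "c \<in> saturation C S"
proof -
  have "right_multiplicative_system C S" using S by (simp add: multiplicative_system_def)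
  note R = right_multiplicative_systemD[OF this]
  obtain g y' h x' where gh: "g \<in> hom C y y'" "g \<cdot> f \<in> S" "h \<in> hom C x' x" "f \<cdot> h \<in> S"
    using saturationE[OF f] .
  obtain w e t where t: "e \<in> hom C y' w" "t \<in> S" "t \<in> hom C z w" "e \<cdot> (g \<cdot> f) = t \<cdot> a"
    using R(4)[OF a gh(2) Comp_in[OF f(2) gh(1)]] by blast
  obtain m where m: "m \<in> hom C q w" "m \<cdot> c = t"
    using univ[OF Comp_in[OF gh(1) t(1)] t(3)] Comp_assoc[OF f(2) gh(1) t(1)] t(4) by auto
  obtain r k s where k: "k \<in> hom C w r" "s \<in> S" "s \<in> hom C q r" "k \<cdot> t = s \<cdot> c"
    using R(4)[OF c t(2,3)] by blast
  have km: "k \<cdot> m \<in> hom C q r" using Comp_in m k by blast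
  have c_eq: "(k \<cdot> m) \<cdot> c = s \<cdot> c" using Comp_assoc[OF c m(1) k(1)] m k by simp
  have fh: "f \<cdot> h \<in> hom C x' y" using Comp_in[OF gh(3) f(2)] .
  have bf: "l \<cdot> b \<cdot> (f \<cdot> h) = l \<cdot> c \<cdot> a \<cdot> h" if l: "l \<in> hom C q r" for l
  proof -
    have "l \<cdot> b \<cdot> (f \<cdot> h) = l \<cdot> b \<cdot> f \<cdot> h"
      using Comp_assoc[OF gh(3) f(2) Comp_in[OF b l]] by simp
    also have "l \<cdot> b \<cdot> f = l \<cdot> c \<cdot> a"
      using Comp_assoc[OF f(2) b l] Comp_assoc[OF a c l] sq by simp
    finally show ?thesis .
  qed
  have "(k \<cdot> m \<cdot> b) \<cdot> (f \<cdot> h) = (s \<cdot> b) \<cdot> (f \<cdot> h)"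
    using bf[OF km] bf[OF k(3)] c_eq by simp
  then obtain r' t' where t': "t' \<in> S" "t' \<in> hom C r r'" "t' \<cdot> (k \<cdot> m \<cdot> b) = t' \<cdot> (s \<cdot> b)"
    using R(5)[OF Comp_in[OF b km] Comp_in[OF b k(3)] gh(4) fh] by blast
  have kmr: "t' \<cdot> (k \<cdot> m) \<in> hom C q r'" "t' \<cdot> s \<in> hom C q r'"
    using Comp_in[OF km t'(2)] Comp_in[OF k(3) t'(2)] by auto
  have "(t' \<cdot> (k \<cdot> m)) \<cdot> b = (t' \<cdot> s) \<cdot> b"
    using t'(3) Comp_assoc[OF b km t'(2)] Comp_assoc[OF b k(3) t'(2)] by simp
  moreover have "(t' \<cdot> (k \<cdot> m)) \<cdot> c = (t' \<cdot> s) \<cdot> c"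
    using c_eq Comp_assoc[OF c km t'(2)] Comp_assoc[OF c k(3) t'(2)] by simp
  moreover have "(t' \<cdot> s) \<cdot> b \<cdot> f = (t' \<cdot> s) \<cdot> c \<cdot> a"
    using Comp_assoc[OF f(2) b kmr(2)] Comp_assoc[OF a c kmr(2)] sq by simp
  ultimately have "t' \<cdot> (k \<cdot> m) = t' \<cdot> s"
    using univ[OF Comp_in[OF b kmr(2)] Comp_in[OF c kmr(2)]] kmr by metis
  then have "(t' \<cdot> k) \<cdot> m \<in> S"
    using R(3)[OF k(2) t'(1) k(3) t'(2)] Comp_assoc[OF m(1) k(1) t'(2)] by simp
  then have "\<exists>v h. h \<in> hom C v z \<and> c \<cdot> h \<in> S"
    using ex_precomposite_if_ex_postcomposites[OF S c m(1) Comp_in[OF k(1) t'(2)]] m(2) t(2) by simp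
  then show ?thesis using saturationI[OF c m(1)] m(2) t(2) by blast
qed

text \<open>By the cancellation condition some \<open>t \<in> S\<close> coequalizes the two arrows and therefore factors
  as \<open>m c\<close>. As \<open>c\<close> is epi, the Ore condition for \<open>t\<close> and \<open>c\<close> gives \<open>k\<close> with \<open>k m \<in> S\<close>.\<close>

lemma saturation_coequalizer:
  assumes S: "multiplicative_system C S"
    and f: "f \<in> saturation C S" "f \<in> hom C w x"
    and g1: "g1 \<in> hom C x y" and g2: "g2 \<in> hom C x y" and eq: "g1 \<cdot> f = g2 \<cdot> f"
    and c: "c \<in> hom C y q" and c_eq: "c \<cdot> g1 = c \<cdot> g2"
    and univ: "\<And>z u. \<lbrakk>u \<in> hom C y z; u \<cdot> g1 = u \<cdot> g2\<rbrakk> \<Longrightarrow> \<exists>!h. h \<in> hom C q z \<and> h \<cdot> c = u"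
  shows "c \<in> saturation C S"
proof -
  have "right_multiplicative_system C S" using S by (simp add: multiplicative_system_def)
  note R = right_multiplicative_systemD[OF this]
  obtain g y' h x' where gh: "g \<in> hom C x y'" "g \<cdot> f \<in> S" "h \<in> hom C x' w" "f \<cdot> h \<in> S"
    using saturationE[OF f] .
  have "g1 \<cdot> (f \<cdot> h) = g2 \<cdot> (f \<cdot> h)"
    using eq Comp_assoc[OF gh(3) f(2) g1] Comp_assoc[OF gh(3) f(2) g2] by simp
  then obtain z t where t: "t \<in> S" "t \<in> hom C y z" "t \<cdot> g1 = t \<cdot> g2"
    using R(5)[OF g1 g2 gh(4) Comp_in[OF gh(3) f(2)]] by blast
  obtain m where m: "m \<in> hom C q z" "m \<cdot> c = t" using univ[OF t(2,3)] by blast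
  obtain r k s where k: "k \<in> hom C z r" "s \<in> S" "s \<in> hom C q r" "k \<cdot> t = s \<cdot> c"
    using R(4)[OF c t(1,2)] by blast
  have "(k \<cdot> m) \<cdot> c = s \<cdot> c" using Comp_assoc[OF c m(1) k(1)] m k by simp
  moreover have "(s \<cdot> c) \<cdot> g1 = (s \<cdot> c) \<cdot> g2"
    using c_eq Comp_assoc[OF g1 c k(3)] Comp_assoc[OF g2 c k(3)] by simp
  ultimately have "k \<cdot> m = s"
    using univ[OF Comp_in[OF c k(3)]] Comp_in[OF m(1) k(1)] k(3) by blast
  then have "\<exists>v h. h \<in> hom C v y \<and> c \<cdot> h \<in> S"
    using ex_precomposite_if_ex_postcomposites[OF S c m(1) k(1)] m(2) t(1) k(2) by simp
  then show ?thesis using saturationI[OF c m(1)] m(2) t(1) by blast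
qed

end

section \<open>Intersections of saturations\<close>

text \<open>Membership in \<open>Arr C\<close> is explicit so that the empty family also gives a set of arrows.\<close>

definition common_saturation :: "('o, 'm, 'z) cat_scheme \<Rightarrow> 'm set set \<Rightarrow> 'm set" where
  "common_saturation C \<T> = {f \<in> Arr C. \<forall>T\<in>\<T>. f \<in> saturation C T}"

text \<open>Pushouts and coequalizers do not refer to any system, so as completing arrows they serve all
  members of the family at once.\<close>

lemma right_multiplicative_system_common_saturation:
  fixes C :: "('o, 'm, 'z) cat_scheme" (structure)
  assumes C: "category C" and cocomplete: "cocomplete_category TYPE('u) C"
    and inf: "infinite (UNIV :: 'u set)"
    and \<T>: "\<And>T. T \<in> \<T> \<Longrightarrow> multiplicative_system C T"
  shows "right_multiplicative_system C (common_saturation C \<T>)"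
proof -
  interpret category C by fact
  have W: "f \<in> common_saturation C \<T> \<longleftrightarrow> f \<in> Arr C \<and> (\<forall>T\<in>\<T>. f \<in> saturation C T)" for f
    by (simp add: common_saturation_def)
  note op = category_op_cat[OF C] cocomplete[unfolded cocomplete_category_def] inf
  show ?thesis
    unfolding right_multiplicative_system_def
  proof (intro conjI ballI allI impI)
    show "common_saturation C \<T> \<subseteq> Arr C" using W by blast
  next
    fix x assume x: "x \<in> Obj C"
    have "Id C x \<in> T" if "T \<in> \<T>" for T
      using right_multiplicative_systemD(2)[OF _ x] \<T>[OF that]
      by (simp add: multiplicative_system_def)
    then have "Id C x \<in> saturation C T" if "T \<in> \<T>" for T
      using subset_saturation[OF \<T>[OF that]] that by blast
    moreover have "Id C x \<in> Arr C" using Id_in[OF x] by (simp add: hom_def)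
    ultimately show "Id C x \<in> common_saturation C \<T>" using W by blast
  next
    fix s t assume s: "s \<in> common_saturation C \<T>" and t: "t \<in> common_saturation C \<T>"
      and st: "Cod C s = Dom C t"
    have h: "s \<in> hom C (Dom C s) (Cod C s)" "t \<in> hom C (Cod C s) (Cod C t)"
      using s t W st by (auto simp: hom_def)
    then have "t \<cdot> s \<in> Arr C" using Comp_in[OF h] by (simp add: hom_def)
    then show "t \<cdot> s \<in> common_saturation C \<T>"
      using s t W saturation_Comp[OF \<T> _ h(1) _ h(2)] by blast
  next
    fix f s assume f: "f \<in> Arr C" and s: "s \<in> common_saturation C \<T>" and fs: "Dom C f = Dom C s"
    have h: "s \<in> hom C (Dom C s) (Cod C s)" "f \<in> hom C (Dom C s) (Cod C f)"
      using s f W fs by (auto simp: hom_def)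
    obtain q b c where q: "b \<in> hom C (Cod C s) q" "c \<in> hom C (Cod C f) q" "b \<cdot> s = c \<cdot> f"
      and univ: "\<And>w u v. \<lbrakk>u \<in> hom C (Cod C s) w; v \<in> hom C (Cod C f) w; u \<cdot> s = v \<cdot> f\<rbrakk> \<Longrightarrow>
        \<exists>!h. h \<in> hom C q w \<and> h \<cdot> b = u \<and> h \<cdot> c = v"
      using pullbacks_exist[OF op, simplified, OF h] by blast
    have "c \<in> saturation C T" if "T \<in> \<T>" for T
      by (rule saturation_pushout[OF \<T>[OF that] _ h q univ]) (use W s that in auto)
    then have "c \<in> common_saturation C \<T>" using W q(2) by (simp add: hom_def)
    then show "\<exists>f2\<in>Arr C. \<exists>t\<in>common_saturation C \<T>. Dom C f2 = Cod C s \<and> Dom C t = Cod C f \<and>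
        Cod C f2 = Cod C t \<and> f2 \<cdot> s = t \<cdot> f"
      using q by (intro bexI[of _ b] bexI[of _ c]) (auto simp: hom_def)
  next
    fix x y g1 g2 s assume g: "g1 \<in> hom C x y" "g2 \<in> hom C x y"
      and s: "s \<in> common_saturation C \<T>" and eq: "Cod C s = x \<and> g1 \<cdot> s = g2 \<cdot> s"
    have h: "s \<in> hom C (Dom C s) x" using s W eq by (auto simp: hom_def)
    obtain q c where q: "c \<in> hom C y q" "c \<cdot> g1 = c \<cdot> g2"
      and univ: "\<And>z u. \<lbrakk>u \<in> hom C y z; u \<cdot> g1 = u \<cdot> g2\<rbrakk> \<Longrightarrow> \<exists>!h. h \<in> hom C q z \<and> h \<cdot> c = u"
      using equalizers_exist[OF op, simplified, OF g] by blast
    have "c \<in> saturation C T" if "T \<in> \<T>" for T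
      by (rule saturation_coequalizer[OF \<T>[OF that] _ h g _ q univ]) (use W s eq that in simp_all)
    then have "c \<in> common_saturation C \<T>" using W q(1) by (simp add: hom_def)
    then show "\<exists>t\<in>common_saturation C \<T>. Dom C t = y \<and> t \<cdot> g1 = t \<cdot> g2"
      using q by (intro bexI[of _ c]) (simp_all add: hom_def)
  qed
qed

lemma common_saturation_op_cat: "common_saturation (op_cat C) \<T> = common_saturation C \<T>"
  by (simp add: common_saturation_def saturation_op_cat)

lemma multiplicative_system_common_saturation:
  assumes C: "category C" and complete: "complete_category TYPE('u) C"
    and cocomplete: "cocomplete_category TYPE('u) C" and inf: "infinite (UNIV :: 'u set)"
    and \<T>: "\<And>T. T \<in> \<T> \<Longrightarrow> multiplicative_system C T"
  shows "multiplicative_system C (common_saturation C \<T>)"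
proof -
  have "is_functor J (op_cat (op_cat C)) D \<longleftrightarrow> is_functor J C D"
    "is_limit_cone J (op_cat (op_cat C)) D x \<phi> \<longleftrightarrow> is_limit_cone J C D x \<phi>"
    for J :: "('u, 'u) cat" and D x \<phi>
    by (simp_all add: is_functor_def is_limit_cone_def is_cone_def)
  then have "cocomplete_category TYPE('u) (op_cat C)"
    using complete by (simp add: cocomplete_category_def complete_category_def)
  then have "right_multiplicative_system (op_cat C) (common_saturation (op_cat C) \<T>)"
    using right_multiplicative_system_common_saturation[OF category_op_cat[OF C] _ inf] \<T>
    by (simp add: multiplicative_system_op_cat)
  then show ?thesis
    using right_multiplicative_system_common_saturation[OF C cocomplete inf \<T>]
    unfolding multiplicative_system_def left_multiplicative_system_def common_saturation_op_cat
    by simp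
qed

lemma is_product_cong:
  "(\<And>i. i \<in> I \<Longrightarrow> X i = Y i) \<Longrightarrow> is_product C I X p \<pi> \<longleftrightarrow> is_product C I Y p \<pi>"
  unfolding is_product_def by simp

lemma is_product_factorization:
  assumes "is_product C I X p \<pi>" "y \<in> Obj C" "\<forall>i\<in>I. \<psi> i \<in> hom C y (X i)"
  shows "\<exists>h. h \<in> hom C y p \<and> (\<forall>i\<in>I. Comp C (\<pi> i) h = \<psi> i)"
  using assms unfolding is_product_def by blast

text \<open>If \<open>g i\<close> and \<open>k i\<close> are the witnesses for \<open>f i\<close>, then the products \<open>G\<close> of the \<open>g i\<close> and
  \<open>K\<close> of the \<open>k i\<close> are witnesses for the product \<open>h\<close> of the \<open>f i\<close>. Completeness provides the
  product of the codomains of the \<open>g i\<close> and that of the domains of the \<open>k i\<close>.\<close>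

lemma closed_under_products_saturation:
  fixes C :: "('o, 'm, 'z) cat_scheme" (structure) and \<kappa> :: "'u rel"
  assumes C: "category C" and complete: "complete_category TYPE('u) C"
    and \<kappa>: "Card_order \<kappa>" and closed: "closed_under_products C \<kappa> S"
  shows "closed_under_products C \<kappa> (saturation C S)"
  unfolding closed_under_products_def
proof (intro allI impI)
  fix I :: "'u set" and f p \<pi> q \<rho> h
  assume *: "|I| <o \<kappa> \<and> (\<forall>i\<in>I. f i \<in> saturation C S) \<and>
    is_product C I (\<lambda>i. Dom C (f i)) p \<pi> \<and> is_product C I (\<lambda>i. Cod C (f i)) q \<rho> \<and>
    h \<in> hom C p q \<and> (\<forall>i\<in>I. Comp C (\<rho> i) h = Comp C (f i) (\<pi> i))"
  interpret category C by fact
  have I: "|I| <o \<kappa>" and h: "h \<in> hom C p q" using * by auto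
  \<comment> \<open>\<open>\<kappa>\<close> is a cardinal on a subset of the universe type, so \<open>\<kappa>\<close>-small families are small.\<close>
  have small: "|I| <o |UNIV :: 'u set|"
    using ordLess_ordIso_trans[OF I ordIso_symmetric[OF card_of_Field_ordIso[OF \<kappa>]]]
      card_of_mono1[OF subset_UNIV, of "Field \<kappa>"] ordLess_ordLeq_trans by blast
  have P: "is_product C I (\<lambda>i. Dom C (f i)) p \<pi>" and Q: "is_product C I (\<lambda>i. Cod C (f i)) q \<rho>"
    using * by auto
  have fh: "f i \<in> hom C (Dom C (f i)) (Cod C (f i))" if "i \<in> I" for i
    using * that by (auto simp: saturation_def hom_def)
  have \<pi>: "\<pi> i \<in> hom C p (Dom C (f i))" and \<rho>: "\<rho> i \<in> hom C q (Cod C (f i))"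
    and nat: "\<rho> i \<cdot> h = f i \<cdot> \<pi> i" if "i \<in> I" for i
    using that P Q * by (auto simp: is_product_def)
  have "\<forall>i\<in>I. \<exists>g. g \<in> hom C (Cod C (f i)) (Cod C g) \<and> g \<cdot> f i \<in> S"
    using * unfolding saturation_def hom_def by blast
  then obtain g where g: "\<And>i. i \<in> I \<Longrightarrow> g i \<in> hom C (Cod C (f i)) (Cod C (g i)) \<and> g i \<cdot> f i \<in> S"
    by metis
  have "\<forall>i\<in>I. \<exists>k. k \<in> hom C (Dom C k) (Dom C (f i)) \<and> f i \<cdot> k \<in> S"
    using * unfolding saturation_def hom_def by blast
  then obtain k where k: "\<And>i. i \<in> I \<Longrightarrow> k i \<in> hom C (Dom C (k i)) (Dom C (f i)) \<and> f i \<cdot> k i \<in> S"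
    by metis
  obtain r \<sigma> where R: "is_product C I (\<lambda>i. Cod C (g i)) r \<sigma>"
    using products_exist[OF C complete small, of "\<lambda>i. Cod C (g i)"] g hom_objs by blast
  obtain t \<tau> where T: "is_product C I (\<lambda>i. Dom C (k i)) t \<tau>"
    using products_exist[OF C complete small, of "\<lambda>i. Dom C (k i)"] k hom_objs by blast
  have \<sigma>: "\<sigma> i \<in> hom C r (Cod C (g i))" and \<tau>: "\<tau> i \<in> hom C t (Dom C (k i))" if "i \<in> I" for i
    using that R T by (auto simp: is_product_def)
  have "\<forall>i\<in>I. g i \<cdot> \<rho> i \<in> hom C q (Cod C (g i))" "\<forall>i\<in>I. k i \<cdot> \<tau> i \<in> hom C t (Dom C (f i))"
    using Comp_in \<rho> g \<tau> k by blast+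
  moreover have "q \<in> Obj C" "t \<in> Obj C" using Q T by (auto simp: is_product_def)
  ultimately obtain G K
    where G: "G \<in> hom C q r" "\<And>i. i \<in> I \<Longrightarrow> \<sigma> i \<cdot> G = g i \<cdot> \<rho> i"
      and K: "K \<in> hom C t p" "\<And>i. i \<in> I \<Longrightarrow> \<pi> i \<cdot> K = k i \<cdot> \<tau> i"
    using is_product_factorization[OF R, of q "\<lambda>i. g i \<cdot> \<rho> i"]
      is_product_factorization[OF P, of t "\<lambda>i. k i \<cdot> \<tau> i"] by blast
  have gf: "g i \<cdot> f i \<in> hom C (Dom C (f i)) (Cod C (g i))" and
    fk: "f i \<cdot> k i \<in> hom C (Dom C (k i)) (Cod C (f i))" if "i \<in> I" for i
    using Comp_in g k fh that by blast+
  have "\<sigma> i \<cdot> (G \<cdot> h) = g i \<cdot> f i \<cdot> \<pi> i" if i: "i \<in> I" for i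
  proof -
    have "\<sigma> i \<cdot> (G \<cdot> h) = g i \<cdot> \<rho> i \<cdot> h" using Comp_assoc[OF h G(1) \<sigma>[OF i]] G(2)[OF i] by simp
    also have "\<dots> = g i \<cdot> (f i \<cdot> \<pi> i)"
      using Comp_assoc[OF h \<rho>[OF i]] g[OF i] nat[OF i] by metis
    also have "\<dots> = g i \<cdot> f i \<cdot> \<pi> i" using Comp_assoc[OF \<pi>[OF i] fh[OF i]] g[OF i] by metis
    finally show ?thesis .
  qed
  moreover have "is_product C I (\<lambda>i. Dom C (g i \<cdot> f i)) p \<pi>"
    "is_product C I (\<lambda>i. Cod C (g i \<cdot> f i)) r \<sigma>"
    using P R gf is_product_cong by (auto simp: is_product_def hom_def)
  ultimately have Gh: "G \<cdot> h \<in> S"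
    using closed[unfolded closed_under_products_def, rule_format,
        of I "\<lambda>i. g i \<cdot> f i" p \<pi> r \<sigma> "G \<cdot> h"] I g Comp_in[OF h G(1)] by blast
  have "\<rho> i \<cdot> (h \<cdot> K) = f i \<cdot> k i \<cdot> \<tau> i" if i: "i \<in> I" for i
  proof -
    have "\<rho> i \<cdot> (h \<cdot> K) = f i \<cdot> \<pi> i \<cdot> K" using Comp_assoc[OF K(1) h \<rho>[OF i]] nat[OF i] by simp
    also have "\<dots> = f i \<cdot> (k i \<cdot> \<tau> i)"
      using Comp_assoc[OF K(1) \<pi>[OF i] fh[OF i]] K(2)[OF i] by simp
    also have "\<dots> = f i \<cdot> k i \<cdot> \<tau> i"
      using Comp_assoc[OF \<tau>[OF i] _ fh[OF i]] k[OF i] by metis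
    finally show ?thesis .
  qed
  moreover have "is_product C I (\<lambda>i. Dom C (f i \<cdot> k i)) t \<tau>"
    "is_product C I (\<lambda>i. Cod C (f i \<cdot> k i)) q \<rho>"
    using Q T fk is_product_cong by (auto simp: is_product_def hom_def)
  ultimately have hK: "h \<cdot> K \<in> S"
    using closed[unfolded closed_under_products_def, rule_format,
        of I "\<lambda>i. f i \<cdot> k i" t \<tau> q \<rho> "h \<cdot> K"] I k Comp_in[OF K(1) h] by blast
  show "h \<in> saturation C S" using saturationI[OF h G(1) Gh K(1) hK] .
qed

lemma closed_under_products_common_saturation:
  fixes \<kappa> :: "'u rel"
  assumes "category C" "complete_category TYPE('u) C" "Card_order \<kappa>"
    and \<T>: "\<And>T. T \<in> \<T> \<Longrightarrow> closed_under_products C \<kappa> T"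
  shows "closed_under_products C \<kappa> (common_saturation C \<T>)"
  unfolding closed_under_products_def
proof (intro allI impI)
  fix I :: "'u set" and f p \<pi> q \<rho> h
  assume *: "|I| <o \<kappa> \<and> (\<forall>i\<in>I. f i \<in> common_saturation C \<T>) \<and>
    is_product C I (\<lambda>i. Dom C (f i)) p \<pi> \<and> is_product C I (\<lambda>i. Cod C (f i)) q \<rho> \<and>
    h \<in> hom C p q \<and> (\<forall>i\<in>I. Comp C (\<rho> i) h = Comp C (f i) (\<pi> i))"
  have "h \<in> saturation C T" if T: "T \<in> \<T>" for T
    using closed_under_products_saturation[OF assms(1-3) \<T>[OF T], unfolded closed_under_products_def,
        rule_format, of I f p \<pi> q \<rho> h] * T
    by (simp add: common_saturation_def)
  then show "h \<in> common_saturation C \<T>" using * by (simp add: common_saturation_def hom_def)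
qed

text \<open>By functoriality of the tensor product, tensoring witnesses with an identity gives witnesses
  for the tensored arrow.\<close>

lemma (in symmetric_monoidal_category) monoidal_arrows_saturation:
  assumes "monoidal_arrows V S"
  shows "monoidal_arrows V (saturation V S)"
  unfolding monoidal_arrows_def
proof (intro ballI)
  fix x f assume x: "x \<in> Obj V" and f: "f \<in> saturation V S"
  have h: "f \<in> hom V (Dom V f) (Cod V f)" using f by (simp add: saturation_def hom_def)
  obtain g z k w where *: "g \<in> hom V (Cod V f) z" "g \<cdot> f \<in> S" "k \<in> hom V w (Dom V f)" "f \<cdot> k \<in> S"
    using saturationE[OF f h] .
  note i = Id_in[OF x]
  have l: "(Id V x \<boxtimes> b) \<cdot> (Id V x \<boxtimes> a) \<in> S" "(b \<boxtimes> Id V x) \<cdot> (a \<boxtimes> Id V x) \<in> S"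
    if "a \<in> hom V u v" "b \<in> hom V v y" "b \<cdot> a \<in> S" for a b u v y
    using tensA_Comp[OF i i that(1,2)] tensA_Comp[OF that(1,2) i i] Id_left[OF i] assms x that(3)
    unfolding monoidal_arrows_def by metis+
  have "Id V x \<boxtimes> f \<in> saturation V S"
    using saturationI[OF tensA_in[OF i h] tensA_in[OF i *(1)] l(1)[OF h *(1,2)]
        tensA_in[OF i *(3)] l(1)[OF *(3) h *(4)]] .
  moreover have "f \<boxtimes> Id V x \<in> saturation V S"
    using saturationI[OF tensA_in[OF h i] tensA_in[OF *(1) i] l(2)[OF h *(1,2)]
        tensA_in[OF *(3) i] l(2)[OF *(3) h *(4)]] .
  ultimately show "Id V x \<boxtimes> f \<in> saturation V S \<and> f \<boxtimes> Id V x \<in> saturation V S" ..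
qed

lemma (in symmetric_monoidal_category) monoidal_arrows_common_saturation:
  assumes "\<And>T. T \<in> \<T> \<Longrightarrow> monoidal_arrows V T"
  shows "monoidal_arrows V (common_saturation V \<T>)"
  unfolding monoidal_arrows_def
proof (intro ballI)
  fix x f assume x: "x \<in> Obj V" and f: "f \<in> common_saturation V \<T>"
  have h: "f \<in> hom V (Dom V f) (Cod V f)" using f by (simp add: common_saturation_def hom_def)
  have "Id V x \<boxtimes> f \<in> Arr V" "f \<boxtimes> Id V x \<in> Arr V"
    using tensA_in[OF Id_in[OF x] h] tensA_in[OF h Id_in[OF x]] by (auto simp: hom_def)
  then show "Id V x \<boxtimes> f \<in> common_saturation V \<T> \<and> f \<boxtimes> Id V x \<in> common_saturation V \<T>"
    using x f monoidal_arrows_saturation[OF assms]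
    by (auto simp: common_saturation_def monoidal_arrows_def)
qed

theorem theorem0p7:
  fixes V :: "('o, 'm) smcat" and \<kappa> :: "'u rel" and S :: "'m set"
  assumes "symmetric_monoidal_category V"
    and "complete_category TYPE('u) V"
    and "cocomplete_category TYPE('u) V"
    and "regular_cardinal \<kappa>"
    and "S \<subseteq> Arr V"
  shows "\<exists>T. closed_monoidal_multiplicative_system V \<kappa> T \<and> S \<subseteq> T \<and>
    (\<forall>T'. closed_monoidal_multiplicative_system V \<kappa> T' \<and> S \<subseteq> T' \<longrightarrow>
      (\<exists>!F. is_functor (localization V T) (localization V T') F \<and>
        fctr_comp V F (localization_fctr V T) = localization_fctr V T'))"
proof -
  interpret symmetric_monoidal_category V by fact
  have C: "category V" by unfold_locales
  have \<kappa>: "Card_order \<kappa>" using assms(4) by (simp add: regular_cardinal_def)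
  have inf: "infinite (UNIV :: 'u set)"
    using assms(4) finite_subset[OF subset_UNIV]
    by (auto simp: regular_cardinal_def cinfinite_def)
  define \<T> where "\<T> = {T. closed_monoidal_multiplicative_system V \<kappa> T \<and> S \<subseteq> T}"
  define T where "T = common_saturation V \<T>"
  have \<T>: "multiplicative_system V T'" "closed_under_products V \<kappa> T'"
    "closed_under_products (op_cat V) \<kappa> T'" "monoidal_arrows V T'" "S \<subseteq> T'" if "T' \<in> \<T>" for T'
    using that
    by (auto simp: \<T>_def closed_monoidal_multiplicative_system_def closed_under_coproducts_def)
  have "closed_under_products (op_cat V) \<kappa> T"
    using closed_under_products_common_saturation[OF category_op_cat[OF C] _ \<kappa> \<T>(3), of \<T>] assms(3)
    by (simp add: T_def cocomplete_category_def common_saturation_op_cat)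
  then have "closed_monoidal_multiplicative_system V \<kappa> T"
    unfolding closed_monoidal_multiplicative_system_def closed_under_coproducts_def T_def
    using multiplicative_system_common_saturation[OF C assms(2,3) inf \<T>(1)]
      closed_under_products_common_saturation[OF C assms(2) \<kappa> \<T>(2)]
      monoidal_arrows_common_saturation[OF \<T>(4)] by blast
  moreover have "S \<subseteq> T"
    using assms(5) \<T>(5) subset_saturation[OF \<T>(1)] by (fastforce simp: T_def common_saturation_def)
  moreover have "\<exists>!F. is_functor (localization V T) (localization V T') F \<and>
      fctr_comp V F (localization_fctr V T) = localization_fctr V T'" if T': "T' \<in> \<T>" for T'
  proof (rule localization_universal[OF C category_localization[OF C] localization_fctr_functor[OF C]])
    fix s assume "s \<in> T"
    then have s: "s \<in> saturation V T'" using T' by (simp add: T_def common_saturation_def)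
    have "T' \<subseteq> Arr V"
      using \<T>(1)[OF T'] right_multiplicative_systemD(1)[of V T']
      by (simp add: multiplicative_system_def)
    then have "is_iso (localization V T') (amap (localization_fctr V T') t)" if "t \<in> T'" for t
      using zz_class_Bwd_inverse[OF C that] that unfolding is_iso_def by blast
    then show "is_iso (localization V T') (amap (localization_fctr V T') s)"
      using is_iso_if_saturation[OF category_localization[OF C] localization_fctr_functor[OF C] _ s]
      by blast
  qed
  ultimately show ?thesis by (auto simp: \<T>_def)
qed

end
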